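(* Consider the one-level space decomposition $V=\sum_{k=1}^N R_k^*V_k$, where $V=S_h(\Omega)$, $V_k=S_h(\Omega_k')$ for $1\le k\le N$, and $R_k^*\colon V_k\to V$ is the extension-by-zero operator. Let $$F_h(u)=\int_\Omega \tfrac12|\nabla u|^2\,dx,\qquad G_h(u)=\int_\Omega I_h(\phi(\cdot,u))\,dx,\qquad u\in V.$$ Then there is a constant $C_0>0$ with $$C_0^2\approx\frac{1}{H\delta},$$ where the constants implicit in $\approx$ are independent of $h$, $H$, $\delta$ and of the function $\phi$, such that the following stable decomposition property holds: for any $u,v\in V$ there exist $w_k\in V_k$, $1\le k\le N$, such that $$u-v=\sum_{k=1}^N R_k^*w_k,$$ $$\sum_{k=1}^N D_{F_h}(v+R_k^*w_k,v)\le\frac{C_0^2}{2}|u-v|_{H^1(\Omega)}^2,$$ $$\sum_{k=1}^N G_h(v+R_k^*w_k)\le G_h(u)+(N-1)G_h(v).$$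
   Context: Domain and nonlinearity: $\Omega\subset\mathbb{R}^d$ ($d=2,3$) is a bounded polyhedral domain, and $\phi(x,y)\colon\Omega\times\mathbb{R}\to\mathbb{R}$ is a smooth function that is convex with respect to $y$ (with values defined at all mesh vertices). Finite elements: $\mathcal{T}_h$ is a quasi-uniform triangulation of $\Omega$ with characteristic element diameter $h$; $S_h(\Omega)$ is the space of continuous functions that are piecewise linear on $\mathcal{T}_h$ and vanish on $\partial\Omega$. $I_h$ is nodal interpolation: $I_hg$ is the continuous piecewise linear function on $\mathcal{T}_h$ agreeing with $g\in C^0(\overline\Omega)$ at all vertices of $\mathcal{T}_h$ (so $\int_\Omega I_h(\phi(\cdot,u))\,dx$ is the trapezoidal-rule approximation of $\int_\Omega\phi(x,u)\,dx$). Domain decomposition: $\mathcal{T}_H$ is a quasi-uniform coarse triangulation of $\Omega$ with characteristic element diameter $H$, and $\mathcal{T}_h$ is a refinement of $\mathcal{T}_H$. $\{\Omega_k\}_{k=1}^N$ is a nonoverlapping decomposition of $\Omega$ such that each $\Omega_k$ is the union of several elements of $\mathcal{T}_H$, the number of coarse elements in each $\Omega_k$ being uniformly bounded. Each $\Omega_k$ is enlarged by layers of fine elements of width $\delta$ to form $\Omega_k'$, so that $\{\Omega_k'\}_{k=1}^N$ is an overlapping decomposition of $\Omega$; the $\Omega_k'$ can be colored with $N_c$ colors such that subdomains of the same color do not intersect, where $N_c\le4$ if $d=2$ and $N_c\le8$ if $d=3$. $S_h(\Omega_k')$ is the continuous piecewise linear finite element space on $\mathcal{T}_h|_{\Omega_k'}$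 with homogeneous Dirichlet boundary condition. There is a piecewise linear partition of unity $\{\theta_k\}_{k=1}^N$ (so $0\le\theta_k\le1$) with $\theta_k=0$ in $\Omega\setminus\Omega_k'$, $\sum_{k=1}^N\theta_k=1$ in $\overline\Omega$, and $|\theta_k|_{W^{1,\infty}(\Omega_k')}\lesssim1/\delta$. Notation: $A\lesssim B$ means $A\le CB$ with a positive constant $C$ independent of $h$, $H$, $\delta$; $A\approx B$ means $A\lesssim B$ and $B\lesssim A$. The Bregman distance of a differentiable functional $F$ is $D_F(u,v)=F(u)-F(v)-\langle F'(v),u-v\rangle$; here $D_{F_h}(u,v)=\frac12\int_\Omega|\nabla(u-v)|^2\,dx$. $|\cdot|_{H^1(\Omega)}$ is the $H^1$-seminorm $|u|_{H^1(\Omega)}^2=\int_\Omega|\nabla u|^2dx$. *)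

theory Defs
  imports "HOL-Analysis.Analysis"
begin

section \<open>Domains and meshes\<close>

definition polyhedral_domain :: "'a::euclidean_space set \<Rightarrow> bool" where
  "polyhedral_domain \<Omega> \<longleftrightarrow>
     (\<exists>\<P>. finite \<P> \<and> (\<forall>P\<in>\<P>. polytope P) \<and> \<Omega> = interior (\<Union>\<P>)) \<and>
     connected \<Omega> \<and> \<Omega> \<noteq> {}"

text \<open>Elements are closed simplices of full dimension; conformity (two elements meet in a common
  face) is part of the library notion \<^const>\<open>triangulation\<close>.\<close>

definition mesh_of :: "'a::euclidean_space set \<Rightarrow> 'a set set \<Rightarrow> bool" where
  "mesh_of \<Omega> \<T> \<longleftrightarrow>
     triangulation \<T> \<and> (\<forall>T\<in>\<T>. int DIM('a) simplex T) \<and> \<Union>\<T> = closure \<Omega>"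

text \<open>All constants hidden in the assumptions on the meshes and on the decomposition are bounded by
  a single parameter \<open>\<kappa>\<close>. Quasi-uniformity with characteristic diameter \<open>h\<close>:
  the outer and inner diameters of every element are comparable to \<open>h\<close>.\<close>

definition quasi_uniform :: "real \<Rightarrow> real \<Rightarrow> 'a::euclidean_space set set \<Rightarrow> bool" where
  "quasi_uniform \<kappa> h \<T> \<longleftrightarrow>
     0 < h \<and> (\<forall>T\<in>\<T>. diameter T \<le> \<kappa> * h \<and> (\<exists>x. cball x (h / \<kappa>) \<subseteq> T))"

definition mesh_refinement :: "'a set set \<Rightarrow> 'a set set \<Rightarrow> bool" where
  "mesh_refinement \<T>h \<T>H \<longleftrightarrow> (\<forall>T\<in>\<T>h. \<exists>K\<in>\<T>H. T \<subseteq> K)"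

definition mesh_vertices :: "'a::euclidean_space set set \<Rightarrow> 'a set" where
  "mesh_vertices \<T> = {x. \<exists>T\<in>\<T>. x extreme_point_of T}"

section \<open>Finite element functions\<close>

text \<open>Only the elements contained in \<open>closure D\<close> matter, i.e. the restriction of the mesh to \<open>D\<close>.\<close>

definition pw_linear :: "'a::euclidean_space set set \<Rightarrow> 'a set \<Rightarrow> ('a \<Rightarrow> real) \<Rightarrow> bool" where
  "pw_linear \<T> D u \<longleftrightarrow>
     continuous_on (closure D) u \<and>
     (\<forall>T\<in>\<T>. T \<subseteq> closure D \<longrightarrow> (\<exists>a b. \<forall>x\<in>T. u x = a \<bullet> x + b))"

text \<open>The space $S_h(D)$ for an open set \<open>D\<close>. Functions on \<open>closure D\<close> are represented by total
  functions that are 0 elsewhere, so that equality of elements of $S_h(D)$ is equality in HOL;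
  inside \<open>closure D\<close> the last conjunct is the homogeneous Dirichlet condition on \<open>frontier D\<close>.\<close>

definition fe_space :: "'a::euclidean_space set set \<Rightarrow> 'a set \<Rightarrow> ('a \<Rightarrow> real) set" where
  "fe_space \<T> D = {u. pw_linear \<T> D u \<and> (\<forall>x. x \<notin> D \<longrightarrow> u x = 0)}"

definition extend_zero :: "'a set \<Rightarrow> ('a \<Rightarrow> real) \<Rightarrow> 'a \<Rightarrow> real" where
  "extend_zero D w = (\<lambda>x. if x \<in> D then w x else 0)"

text \<open>Nodal interpolation on the closed set \<open>closure \<Omega>\<close>, again with value 0 elsewhere. No boundary
  condition is imposed. Only the values of \<open>g\<close> at mesh vertices enter.\<close>

definition nodal_interp ::
  "'a::euclidean_space set set \<Rightarrow> 'a set \<Rightarrow> ('a \<Rightarrow> real) \<Rightarrow> 'a \<Rightarrow> real" where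
  "nodal_interp \<T> \<Omega> g =
     (THE p. pw_linear \<T> \<Omega> p \<and> (\<forall>x\<in>mesh_vertices \<T>. p x = g x) \<and>
             (\<forall>x. x \<notin> closure \<Omega> \<longrightarrow> p x = 0))"

text \<open>Pointwise gradient. For continuous piecewise linear functions it exists off a null set (the
  element boundaries) and coincides almost everywhere with the weak gradient.\<close>

definition grad :: "('a::euclidean_space \<Rightarrow> real) \<Rightarrow> 'a \<Rightarrow> 'a" where
  "grad u x = (THE g. GDERIV u x :> g)"

definition H1_seminorm :: "'a::euclidean_space set \<Rightarrow> ('a \<Rightarrow> real) \<Rightarrow> real" where
  "H1_seminorm \<Omega> u = sqrt (LINT x:\<Omega>|lebesgue. (norm (grad u x))\<^sup>2)"

section \<open>Energies\<close>

definition F_h :: "'a::euclidean_space set \<Rightarrow> ('a \<Rightarrow> real) \<Rightarrow> real" where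
  "F_h \<Omega> u = (LINT x:\<Omega>|lebesgue. 1/2 * (norm (grad u x))\<^sup>2)"

definition G_h ::
  "'a::euclidean_space set set \<Rightarrow> 'a set \<Rightarrow> ('a \<Rightarrow> real \<Rightarrow> real) \<Rightarrow> ('a \<Rightarrow> real) \<Rightarrow> real" where
  "G_h \<T> \<Omega> \<phi> u = (LINT x:\<Omega>|lebesgue. nodal_interp \<T> \<Omega> (\<lambda>y. \<phi> y (u y)) x)"

text \<open>Bregman distance; $\langle F'(v), u - v\rangle$ is the derivative of \<open>F\<close> at \<open>v\<close> in direction
  \<open>u - v\<close>.\<close>

definition bregman :: "(('a \<Rightarrow> real) \<Rightarrow> real) \<Rightarrow> ('a \<Rightarrow> real) \<Rightarrow> ('a \<Rightarrow> real) \<Rightarrow> real" where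
  "bregman F u v = F u - F v - deriv (\<lambda>t::real. F (\<lambda>x. v x + t * (u x - v x))) 0"

text \<open>$C^\infty$ on an open set: all iterated partial derivatives exist and are continuous, the
  functions in question being differentiable at each stage.\<close>

primrec Ck_on :: "nat \<Rightarrow> 'b::euclidean_space set \<Rightarrow> ('b \<Rightarrow> real) \<Rightarrow> bool" where
  "Ck_on 0 S f \<longleftrightarrow> continuous_on S f"
| "Ck_on (Suc n) S f \<longleftrightarrow>
     (\<forall>z\<in>S. f differentiable (at z)) \<and>
     (\<forall>b\<in>Basis. Ck_on n S (\<lambda>z. frechet_derivative f (at z) b))"

definition smooth_on :: "'b::euclidean_space set \<Rightarrow> ('b \<Rightarrow> real) \<Rightarrow> bool" where
  "smooth_on S f \<longleftrightarrow> (\<forall>n. Ck_on n S f)"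

text \<open>Beyond smoothness on \<open>\<Omega> \<times> UNIV\<close> nothing is required of the values of \<open>\<phi>\<close> at vertices on the
  boundary; they are defined because \<open>\<phi>\<close> is total.\<close>

definition admissible_nonlinearity ::
  "'a::euclidean_space set \<Rightarrow> ('a \<Rightarrow> real \<Rightarrow> real) \<Rightarrow> bool" where
  "admissible_nonlinearity \<Omega> \<phi> \<longleftrightarrow>
     smooth_on (\<Omega> \<times> UNIV) (\<lambda>(x, y). \<phi> x y) \<and> (\<forall>x\<in>\<Omega>. convex_on UNIV (\<phi> x))"

section \<open>Domain decomposition\<close>

text \<open>Subdomains are open sets indexed by \<open>{1..N}\<close>.\<close>

definition union_of_elements :: "'a::euclidean_space set set \<Rightarrow> 'a set \<Rightarrow> bool" where
  "union_of_elements \<T> D \<longleftrightarrow> (\<exists>\<E>\<subseteq>\<T>. D = interior (\<Union>\<E>))"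

definition nonoverlapping_decomposition ::
  "'a::euclidean_space set \<Rightarrow> 'a set set \<Rightarrow> nat \<Rightarrow> nat \<Rightarrow> (nat \<Rightarrow> 'a set) \<Rightarrow> bool" where
  "nonoverlapping_decomposition \<Omega> \<T>H M N D \<longleftrightarrow>
     (\<forall>k\<in>{1..N}. \<exists>\<E>\<subseteq>\<T>H. \<E> \<noteq> {} \<and> card \<E> \<le> M \<and> D k = interior (\<Union>\<E>)) \<and>
     (\<forall>i\<in>{1..N}. \<forall>j\<in>{1..N}. i \<noteq> j \<longrightarrow> D i \<inter> D j = {}) \<and>
     (\<Union>k\<in>{1..N}. closure (D k)) = closure \<Omega>"

text \<open>Enlargement of \<open>D k\<close> to \<open>D' k\<close> by fine elements, the added layers having width comparable to
  \<open>\<delta>\<close>. Since the layers lie in \<open>\<Omega>\<close>, their width is at most \<open>diameter \<Omega>\<close>; this has to be said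
  explicitly because the other conditions do not bound \<open>\<delta>\<close> from above when \<open>D' k = \<Omega>\<close>.\<close>

definition enlarged_by_layers ::
  "'a::euclidean_space set \<Rightarrow> 'a set set \<Rightarrow> real \<Rightarrow> nat \<Rightarrow> (nat \<Rightarrow> 'a set) \<Rightarrow> real \<Rightarrow>
   (nat \<Rightarrow> 'a set) \<Rightarrow> bool" where
  "enlarged_by_layers \<Omega> \<T>h \<kappa> N D \<delta> D' \<longleftrightarrow>
     0 < \<delta> \<and> \<delta> \<le> diameter \<Omega> \<and>
     (\<forall>k\<in>{1..N}.
        union_of_elements \<T>h (D' k) \<and> D k \<subseteq> D' k \<and>
        (\<forall>x\<in>D' k. infdist x (D k) \<le> \<kappa> * \<delta>) \<and>
        (\<forall>x\<in>\<Omega>. infdist x (D k) < \<delta> / \<kappa> \<longrightarrow> x \<in> D' k))"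

definition colorable_with :: "nat \<Rightarrow> nat \<Rightarrow> (nat \<Rightarrow> 'a set) \<Rightarrow> bool" where
  "colorable_with Nc N D' \<longleftrightarrow>
     (\<exists>c :: nat \<Rightarrow> nat. (\<forall>k\<in>{1..N}. c k < Nc) \<and>
        (\<forall>i\<in>{1..N}. \<forall>j\<in>{1..N}. i \<noteq> j \<and> c i = c j \<longrightarrow> D' i \<inter> D' j = {}))"

text \<open>The last conjunct is $|\theta_k|_{W^{1,\infty}(\Omega_k')} \le \kappa/\delta$.\<close>

definition pl_partition_of_unity ::
  "'a::euclidean_space set \<Rightarrow> 'a set set \<Rightarrow> real \<Rightarrow> nat \<Rightarrow> real \<Rightarrow> (nat \<Rightarrow> 'a set) \<Rightarrow>
   (nat \<Rightarrow> 'a \<Rightarrow> real) \<Rightarrow> bool" where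
  "pl_partition_of_unity \<Omega> \<T>h \<kappa> N \<delta> D' \<theta> \<longleftrightarrow>
     (\<forall>k\<in>{1..N}. pw_linear \<T>h \<Omega> (\<theta> k) \<and>
        (\<forall>x\<in>closure \<Omega>. 0 \<le> \<theta> k x \<and> \<theta> k x \<le> 1) \<and>
        (\<forall>x\<in>\<Omega> - D' k. \<theta> k x = 0)) \<and>
     (\<forall>x\<in>closure \<Omega>. (\<Sum>k=1..N. \<theta> k x) = 1) \<and>
     (\<forall>k\<in>{1..N}. AE x in lebesgue. x \<in> D' k \<longrightarrow> norm (grad (\<theta> k) x) \<le> \<kappa> / \<delta>)"

end

theory Submission
  imports Defs
begin

text \<open>Put \<open>e = u - v\<close>. The decomposition is \<open>w k = I\<^sub>h (\<theta> k * e)\<close>: nodal interpolation makes the product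
piecewise linear again, the \<open>w k\<close> add up to \<open>I\<^sub>h e = e\<close>, and since \<open>\<theta> k * e\<close> vanishes at all vertices
outside \<open>D' k\<close>, so does its interpolant at all points outside \<open>D' k\<close> (\<open>pw_linear_zero_off_union\<close>).

The nonlinear estimate is a statement about vertices, because \<open>G_h\<close> integrates a nodal interpolant and
interpolation preserves inequalities. At an interior vertex \<open>v + w k = (1 - \<theta> k) v + \<theta> k u\<close> is a convex
combination, so convexity of \<open>\<phi>\<close> and \<open>\<Sum>k. \<theta> k = 1\<close> give
\<open>\<Sum>k. \<phi>(v + w k) \<le> \<phi>(u) + (N - 1) \<phi>(v)\<close>; at a boundary vertex all functions vanish and equality holds.

For the energy, the Bregman distance of the quadratic functional \<open>F_h\<close> is half the squared seminorm
of \<open>w k\<close>. On a fine element a discrete product rule (\<open>nodal_product_gradient\<close>) bounds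
\<open>|\<nabla>w k|\<^sup>2\<close> by a multiple of \<open>|\<nabla>e|\<^sup>2 + |\<nabla>\<theta> k|\<^sup>2 e\<^sup>2\<close>. Here \<open>|\<nabla>\<theta> k| \<le> \<kappa>/\<delta>\<close>, at most \<open>Nc\<close> subdomains
contribute to one element, and \<open>\<nabla>\<theta> k\<close> can be nonzero only where two enlarged subdomains overlap. Such
points lie within distance \<open>\<kappa>\<delta>\<close> of the boundary of the coarse element \<open>K\<close> that contains them
(\<open>gradient_in_boundary_layer\<close>), so it remains to bound \<open>\<delta>\<^sup>-\<^sup>2 \<Sum>K. \<integral> e\<^sup>2\<close> over these layers.

Integrating \<open>e\<^sup>2\<close> over the whole domain instead would cost a factor \<open>1/\<delta>\<^sup>2\<close>. The better factor
\<open>1/(H\<delta>)\<close> comes from the thinness of the layers: comparing a point of the layer with its images under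
dilations about an interior point of \<open>K\<close>, which sweep through \<open>K\<close> evenly, shows that the layer integral is
bounded by \<open>\<delta>/H\<close> times \<open>\<integral>\<^sub>K e\<^sup>2 + H\<^sup>2 \<integral>\<^sub>K |\<nabla>e|\<^sup>2\<close> (\<open>boundary_layer_estimate\<close>). Summation over \<open>K\<close> and the
Friedrichs inequality leave \<open>(1/(H\<delta>) + H/\<delta>) |e|\<^sup>2\<close> up to constants, and \<open>1\<close> and \<open>H/\<delta>\<close> are both bounded by
multiples of \<open>1/(H\<delta>)\<close> as \<open>\<delta>\<close> and \<open>H\<close> are at most a multiple of the diameter of \<open>\<Omega>\<close>. Every constant is explicit
in \<open>\<kappa>\<close>, the dimension, \<open>Nc\<close> and that diameter, so \<open>C0\<^sup>2\<close> can be taken as exactly \<open>c/(H\<delta>)\<close>.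

Both integral inequalities rest on \<open>line_estimate\<close>, the fundamental theorem of calculus along a line.
It holds on every line, also on those running inside element boundaries, because the almost everywhere
defined \<open>|\<nabla>u|\<^sup>2\<close> is replaced there by the everywhere defined function \<open>grad_sq\<close>.\<close>

section \<open>Geometry of simplicial meshes\<close>

lemma mesh_finite: "mesh_of \<Omega> \<T> \<Longrightarrow> finite \<T>"
  by (simp add: mesh_of_def triangulation_def)

lemma mesh_Union: "mesh_of \<Omega> \<T> \<Longrightarrow> \<Union>\<T> = closure \<Omega>"
  by (simp add: mesh_of_def)

lemma mesh_Int_face:
  assumes "mesh_of \<Omega> \<T>" "T \<in> \<T>" "T' \<in> \<T>"
  shows "T \<inter> T' face_of T"
  using assms by (simp add: mesh_of_def triangulation_def)

lemma mesh_element: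
  fixes \<Omega> :: "'a::euclidean_space set"
  assumes "mesh_of \<Omega> \<T>" "T \<in> \<T>"
  shows "convex T" "compact T" "closed T" "interior T \<noteq> {}" "T \<subseteq> closure \<Omega>"
    "aff_dim T = DIM('a)" "bounded T"
proof -
  have s: "int DIM('a) simplex T"
    using assms by (simp add: mesh_of_def)
  show c: "convex T" and "compact T" "closed T" and a: "aff_dim T = DIM('a)"
    using s by (auto intro: convex_simplex compact_simplex closed_simplex aff_dim_simplex)
  then show "bounded T" by (simp add: compact_imp_bounded)
  have "T \<noteq> {}" using a by auto
  moreover have "affine hull T = UNIV" using a by (simp add: aff_dim_eq_full)
  ultimately show "interior T \<noteq> {}"
    using rel_interior_eq_empty[OF c] rel_interior_interior[of T] by simp
  show "T \<subseteq> closure \<Omega>"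
    using assms by (auto simp: mesh_of_def)
qed

lemma mesh_element_hull:
  assumes "mesh_of \<Omega> \<T>" "T \<in> \<T>"
  shows "T = convex hull {x. x extreme_point_of T}"
  using Krein_Milman_Minkowski mesh_element[OF assms] by blast

lemma extreme_point_mesh_vertex:
  "T \<in> \<T> \<Longrightarrow> x extreme_point_of T \<Longrightarrow> x \<in> mesh_vertices \<T>"
  by (auto simp: mesh_vertices_def)

lemma mesh_vertices_subset:
  assumes "mesh_of \<Omega> \<T>"
  shows "mesh_vertices \<T> \<subseteq> closure \<Omega>"
  using mesh_element[OF assms] by (force simp: mesh_vertices_def extreme_point_of_def)

text \<open>The intersection is a face; a face containing an interior point is the whole simplex, and then
equality of dimensions forces the two elements to coincide.\<close>

lemma mesh_interior_disjoint:
  fixes \<Omega> :: "'a::euclidean_space set"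
  assumes m: "mesh_of \<Omega> \<T>" and T: "T \<in> \<T>" and T': "T' \<in> \<T>" and ne: "T \<noteq> T'"
  shows "interior T \<inter> T' = {}"
proof -
  note c = mesh_element(1)[OF m] and a = mesh_element(6)[OF m]
  have "T \<inter> T' \<noteq> T"
  proof
    assume eq: "T \<inter> T' = T"
    then have "T face_of T'"
      using mesh_Int_face[OF m T' T] by (simp add: inf_commute)
    then show False
      using face_of_aff_dim_lt[OF c[OF T'] _ ne] a[OF T] a[OF T'] by simp
  qed
  then have "(T \<inter> T') \<inter> interior T = {}"
    using face_of_disjoint_interior mesh_Int_face[OF m T T'] by blast
  then show ?thesis
    using interior_subset by blast
qed

text \<open>The interior of a union of elements cannot cut through another element.
This makes membership in a subdomain a property of whole elements.\<close>

lemma mesh_interior_cases: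
  assumes m: "mesh_of \<Omega> \<T>" and E: "\<E> \<subseteq> \<T>" and T: "T \<in> \<T>"
  shows "if T \<in> \<E> then interior T \<subseteq> interior (\<Union>\<E>) else interior T \<inter> \<Union>\<E> = {}"
proof (cases "T \<in> \<E>")
  case False
  have "interior T \<inter> S = {}" if "S \<in> \<E>" for S
    using mesh_interior_disjoint[OF m T, of S] that E False by blast
  then show ?thesis using False by auto
qed (simp add: Sup_upper interior_mono)

text \<open>A finite union of polytopes is closed, so its interior has no slits: \<open>\<Omega>\<close> is recovered from its closure.
Consequently the interior of every mesh element lies in \<open>\<Omega>\<close>.\<close>

lemma polyhedral_domain_regular:
  fixes \<Omega> :: "'a::euclidean_space set"
  assumes "polyhedral_domain \<Omega>"
  shows "interior (closure \<Omega>) = \<Omega>" "open \<Omega>" "bounded \<Omega>" "\<Omega> \<noteq> {}"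
proof -
  obtain \<P> where P: "finite \<P>" "\<And>P. P\<in>\<P> \<Longrightarrow> polytope P" "\<Omega> = interior (\<Union>\<P>)" and "\<Omega> \<noteq> {}"
    using assms by (auto simp: polyhedral_domain_def)
  then show "open \<Omega>" "\<Omega> \<noteq> {}" by auto
  have "closed (\<Union>\<P>)"
    using P by (intro closed_Union) (auto intro: polytope_imp_closed)
  then have "closure \<Omega> \<subseteq> \<Union>\<P>"
    using P(3) interior_subset by (metis closure_minimal)
  then show "interior (closure \<Omega>) = \<Omega>"
    using \<open>open \<Omega>\<close> P(3) by (metis closure_subset interior_eq interior_mono subset_antisym)
  have "bounded (\<Union>\<P>)"
    using P by (intro bounded_Union) (auto intro: polytope_imp_bounded)
  then show "bounded \<Omega>"
    using P(3) bounded_subset interior_subset by blast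
qed

text \<open>All points of the open segment from \<open>v\<close> to \<open>f\<close> have the same local structure as far as the mesh is
concerned: by conformity an element containing one of them contains the whole segment. Hence a neighbourhood
of a point near \<open>v\<close> covered by \<open>\<E>\<close> can be moved to \<open>x\<close> by the homothety with centre \<open>f\<close>, which maps each of
the elements involved into itself.\<close>

lemma mesh_star:
  fixes \<Omega> :: "'a::euclidean_space set"
  assumes m: "mesh_of \<Omega> \<T>" and E: "\<E> \<subseteq> \<T>" and T: "T \<in> \<T>"
    and v: "v \<in> T" "v \<in> interior (\<Union>\<E>)" and f: "f \<in> T" and x: "x \<in> open_segment v f"
  shows "x \<in> interior (\<Union>\<E>)"
proof -
  obtain l where l: "0 < l" "l < 1" "x = (1 - l) *\<^sub>R v + l *\<^sub>R f" and vf: "v \<noteq> f"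
    using x by (auto simp: in_segment)
  obtain e where e: "e > 0" "ball v e \<subseteq> \<Union>\<E>"
    using v by (auto simp: mem_interior)
  \<comment> \<open>The parameter \<open>\<eta>\<close> of the auxiliary point is below \<open>e / norm (f - v)\<close> to keep it in the ball, and
    below \<open>l\<close> to place it between \<open>v\<close> and \<open>x\<close>.\<close>
  define \<eta> where "\<eta> = min (l / 2) (e / (2 * norm (f - v)))"
  have \<eta>: "0 < \<eta>" "\<eta> < l" "\<eta> * norm (f - v) < e"
  proof -
    show "0 < \<eta>" "\<eta> < l" using l e vf by (auto simp: \<eta>_def)
    have "\<eta> * norm (f - v) \<le> e / (2 * norm (f - v)) * norm (f - v)"
      unfolding \<eta>_def by (intro mult_right_mono) auto
    also have "\<dots> < e" using e vf by simp
    finally show "\<eta> * norm (f - v) < e" .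
  qed
  define x' where "x' = (1 - \<eta>) *\<^sub>R v + \<eta> *\<^sub>R f"
  have x'_seg: "x' \<in> open_segment v f"
      using \<eta>(1,2) l vf unfolding x'_def in_segment by (intro conjI exI[of _ \<eta>]) auto
  have "x' - v = \<eta> *\<^sub>R (f - v)" by (simp add: x'_def algebra_simps)
  then have "x' \<in> ball v e"
    using \<eta> by (simp add: dist_norm norm_minus_commute[of v])
  then have x'int: "x' \<in> interior (\<Union>\<E>)"
    using e(2) interior_maximal open_ball by blast
  \<comment> \<open>Elements missing \<open>x'\<close> keep a positive distance from it, as there are finitely many.\<close>
  define B where "B = \<Union>{S \<in> \<E>. x' \<notin> S}"
  have "closed B"
    unfolding B_def using E mesh_finite[OF m] mesh_element(3)[OF m]
    by (intro closed_Union) (auto intro: finite_subset)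
  then have "open (interior (\<Union>\<E>) - B)" "x' \<in> interior (\<Union>\<E>) - B"
    using x'int by (auto simp: B_def)
  then obtain r where r: "r > 0" "ball x' r \<subseteq> interior (\<Union>\<E>) - B"
    by (meson open_contains_ball)
  define \<mu> where "\<mu> = (1 - l) / (1 - \<eta>)"
  have \<mu>: "0 < \<mu>" "\<mu> < 1" using \<eta> l by (auto simp: \<mu>_def field_simps)
  have \<mu>\<eta>: "\<mu> * (1 - \<eta>) = 1 - l" using \<eta> l by (simp add: \<mu>_def)
  have xeq: "x = (1 - \<mu>) *\<^sub>R f + \<mu> *\<^sub>R x'"
  proof -
    have "(1 - \<mu>) *\<^sub>R f + \<mu> *\<^sub>R x' = (\<mu> * (1 - \<eta>)) *\<^sub>R v + (1 - \<mu> * (1 - \<eta>)) *\<^sub>R f"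
      by (simp add: x'_def algebra_simps)
    then show ?thesis using l(3) \<mu>\<eta> by simp
  qed
  have "ball x (\<mu> * r) \<subseteq> \<Union>\<E>"
  proof
    fix y assume y: "y \<in> ball x (\<mu> * r)"
    define p where "p = x' + (y - x) /\<^sub>R \<mu>"
    have "p \<in> ball x' r"
    proof -
      have "p - x' = (1 / \<mu>) *\<^sub>R (y - x)"
        by (simp add: p_def inverse_eq_divide)
      then have "dist p x' = (1 / \<mu>) * norm (y - x)"
        using \<mu> by (simp only: dist_norm norm_scaleR) simp
      moreover have "norm (y - x) < \<mu> * r"
        using y by (simp add: dist_norm norm_minus_commute)
      ultimately have "dist p x' < r"
        using \<mu> by (simp add: pos_divide_less_eq mult.commute)
      then show ?thesis by (simp add: dist_commute)
    qed
    then have "p \<in> interior (\<Union>\<E>)" "p \<notin> B" using r by auto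
    then have "p \<in> \<Union>\<E>" "p \<notin> B" using interior_subset by auto
    then obtain S where S: "S \<in> \<E>" "p \<in> S" "x' \<in> S"
      by (auto simp: B_def)
    have "x' \<in> T \<inter> S"
      using S x'_seg closed_segment_subset[OF v(1) f mesh_element(1)[OF m T]] open_closed_segment by blast
    then have "f \<in> S"
      using mesh_Int_face[OF m T, of S] S E v f x'_seg unfolding face_of_def by blast
    moreover have "y = (1 - \<mu>) *\<^sub>R f + \<mu> *\<^sub>R p"
      using \<mu> by (simp add: p_def xeq algebra_simps)
    ultimately have "y \<in> S"
      using mesh_element(1)[OF m, of S] S E \<mu> by (auto simp: convex_alt)
    then show "y \<in> \<Union>\<E>" using S by auto
  qed
  then show ?thesis
    unfolding mem_interior using \<mu>(1) r(1) mult_pos_pos by blast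
qed

section \<open>Continuous piecewise linear functions and nodal interpolation\<close>

lemma pw_linear_element:
  assumes "mesh_of \<Omega> \<T>" "pw_linear \<T> \<Omega> u" "T \<in> \<T>"
  obtains a b where "\<And>x. x \<in> T \<Longrightarrow> u x = a \<bullet> x + b"
  using assms mesh_element(5) unfolding pw_linear_def by metis

lemma pw_linear_lincomb:
  assumes "pw_linear \<T> D u" "pw_linear \<T> D v"
  shows "pw_linear \<T> D (\<lambda>x. c * u x + d * v x)"
  unfolding pw_linear_def
proof (intro conjI ballI impI)
  show "continuous_on (closure D) (\<lambda>x. c * u x + d * v x)"
    using assms by (auto simp: pw_linear_def intro!: continuous_intros)
  fix T assume "T \<in> \<T>" "T \<subseteq> closure D"
  then obtain a b a' b' where "\<forall>x\<in>T. u x = a \<bullet> x + b" "\<forall>x\<in>T. v x = a' \<bullet> x + b'"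
    using assms unfolding pw_linear_def by meson
  then have "\<forall>x\<in>T. c * u x + d * v x = (c *\<^sub>R a + d *\<^sub>R a') \<bullet> x + (c * b + d * b')"
    by (simp add: algebra_simps inner_simps)
  then show "\<exists>a b. \<forall>x\<in>T. c * u x + d * v x = a \<bullet> x + b" by blast
qed

lemma pw_linear_const: "pw_linear \<T> D (\<lambda>x. c)"
  unfolding pw_linear_def by (auto intro!: exI[of _ 0] exI[of _ c])

lemma pw_linear_sum:
  assumes "\<And>i. i \<in> I \<Longrightarrow> pw_linear \<T> D (f i)"
  shows "pw_linear \<T> D (\<lambda>x. \<Sum>i\<in>I. f i x)"
  using assms
proof (induction I rule: infinite_finite_induct)
  case (insert i I)
  then show ?case
    using pw_linear_lincomb[of \<T> D "f i" "\<lambda>x. \<Sum>i\<in>I. f i x" 1 1] by simp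
qed (auto simp: pw_linear_const)

lemma affine_ge_on_hull:
  assumes "\<And>x. x \<in> S \<Longrightarrow> 0 \<le> a \<bullet> x + b" "x \<in> convex hull S"
  shows "0 \<le> a \<bullet> x + (b::real)"
proof -
  have "convex hull S \<subseteq> {x. a \<bullet> x \<ge> - b}"
    using assms(1) by (intro hull_minimal convex_halfspace_ge) force
  then show ?thesis using assms(2) by auto
qed

lemma pw_linear_nonneg:
  assumes m: "mesh_of \<Omega> \<T>" and u: "pw_linear \<T> \<Omega> u"
    and v: "\<And>x. x \<in> mesh_vertices \<T> \<Longrightarrow> 0 \<le> u x" and x: "x \<in> closure \<Omega>"
  shows "0 \<le> u x"
proof -
  obtain T where T: "T \<in> \<T>" "x \<in> T" using x mesh_Union[OF m] by auto
  obtain a b where ab: "\<And>x. x \<in> T \<Longrightarrow> u x = a \<bullet> x + b"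
    using pw_linear_element[OF m u T(1)] by blast
  have "0 \<le> a \<bullet> x + b"
  proof (rule affine_ge_on_hull)
    show "x \<in> convex hull {x. x extreme_point_of T}"
      using mesh_element_hull[OF m T(1)] T by blast
    fix y assume "y \<in> {x. x extreme_point_of T}"
    then show "0 \<le> a \<bullet> y + b"
      using v[OF extreme_point_mesh_vertex[OF T(1)]] ab by (force simp: extreme_point_of_def)
  qed
  then show ?thesis using ab T by simp
qed

lemma pw_linear_unique:
  assumes m: "mesh_of \<Omega> \<T>" and u: "pw_linear \<T> \<Omega> u" and v: "pw_linear \<T> \<Omega> v"
    and eq: "\<And>x. x \<in> mesh_vertices \<T> \<Longrightarrow> u x = v x" and x: "x \<in> closure \<Omega>"
  shows "u x = v x"
  using pw_linear_nonneg[OF m pw_linear_lincomb[OF u v, of 1 "-1"] _ x]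
    pw_linear_nonneg[OF m pw_linear_lincomb[OF v u, of 1 "-1"] _ x] eq by force

text \<open>Translating one point of an affinely independent set to the origin makes the others linearly
independent, and there is a linear functional with prescribed values on these.\<close>

lemma affine_interpolation:
  fixes C :: "'a::euclidean_space set" and g :: "'a \<Rightarrow> real"
  assumes "\<not> affine_dependent C"
  shows "\<exists>a b. \<forall>x\<in>C. a \<bullet> x + b = g x"
proof (cases "C = {}")
  case False
  then obtain c where c: "c \<in> C" by auto
  let ?B = "(\<lambda>x. - c + x) ` (C - {c})"
  have "independent ?B"
    using assms affine_dependent_iff_dependent2[OF c] by simp
  then obtain f :: "'a \<Rightarrow> real" where f: "linear f" "\<forall>y\<in>?B. f y = g (c + y) - g c"
    using linear_independent_extend[of ?B "\<lambda>y. g (c + y) - g c"] by blast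
  define a where "a = adjoint f 1"
  have a: "a \<bullet> x = f x" for x
    using adjoint_works[OF f(1), of x 1] by (simp add: a_def inner_commute)
  have "a \<bullet> x + (g c - a \<bullet> c) = g x" if "x \<in> C" for x
  proof (cases "x = c")
    case False
    then have "f (- c + x) = g x - g c" using f(2) that by auto
    then show ?thesis
      by (simp add: a[symmetric] inner_simps)
  qed simp
  then show ?thesis by blast
qed simp

text \<open>The elementwise affine interpolants fit together: two elements meet in a common face, whose extreme
points are vertices of both, so the two affine functions agree on its extreme points and then on the face.\<close>

lemma ex_pw_linear_interpolant:
  fixes \<Omega> :: "'a::euclidean_space set" and g :: "'a \<Rightarrow> real"
  assumes m: "mesh_of \<Omega> \<T>"
  shows "\<exists>p. pw_linear \<T> \<Omega> p \<and> (\<forall>x\<in>mesh_vertices \<T>. p x = g x) \<and> (\<forall>x. x \<notin> closure \<Omega> \<longrightarrow> p x = 0)"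
proof -
  have "\<exists>a b. \<forall>x. x extreme_point_of T \<longrightarrow> a \<bullet> x + b = g x" if T: "T \<in> \<T>" for T
  proof -
    obtain C where "\<not> affine_dependent C" "T = convex hull C"
      using m T by (auto simp: mesh_of_def simplex_def)
    then show ?thesis
      using affine_interpolation[of C g] extreme_point_of_convex_hull[of _ C] by metis
  qed
  then obtain a b where ab: "\<And>T x. T \<in> \<T> \<Longrightarrow> x extreme_point_of T \<Longrightarrow> a T \<bullet> x + b T = g x"
    by metis
  have agree: "a T \<bullet> x + b T = a S \<bullet> x + b S"
    if T: "T \<in> \<T>" and S: "S \<in> \<T>" and x: "x \<in> T" "x \<in> S" for T S x
  proof -
    have f: "T \<inter> S face_of T" "T \<inter> S face_of S"
      using mesh_Int_face[OF m T S] mesh_Int_face[OF m S T] by (simp_all add: inf_commute)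
    let ?E = "{x. x extreme_point_of T \<inter> S}"
    have "compact (T \<inter> S)" "convex (T \<inter> S)"
      using mesh_element[OF m T] mesh_element[OF m S] by (auto intro: compact_Int convex_Int)
    then have hull: "x \<in> convex hull ?E"
      using Krein_Milman_Minkowski x by blast
    have E: "a T \<bullet> y + b T = a S \<bullet> y + b S" if "y \<in> ?E" for y
    proof -
      have "y extreme_point_of T" "y extreme_point_of S"
        using that extreme_point_of_face[OF f(1), of y] extreme_point_of_face[OF f(2), of y] by blast+
      then show ?thesis using ab[OF T] ab[OF S] by simp
    qed
    have "0 \<le> (a T - a S) \<bullet> x + (b T - b S)" "0 \<le> (a S - a T) \<bullet> x + (b S - b T)"
      by (rule affine_ge_on_hull[OF _ hull]; use E in \<open>force simp: inner_diff_left\<close>)+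
    then show ?thesis by (simp add: inner_diff_left)
  qed
  define p where "p x = (if x \<in> closure \<Omega> then (let T = (SOME T. T \<in> \<T> \<and> x \<in> T) in a T \<bullet> x + b T) else 0)" for x
  have p: "p x = a T \<bullet> x + b T" if T: "T \<in> \<T>" "x \<in> T" for T x
  proof -
    let ?S = "SOME T. T \<in> \<T> \<and> x \<in> T"
    have "?S \<in> \<T> \<and> x \<in> ?S" using that by (intro someI) auto
    then show ?thesis
      using agree[OF T(1), of ?S x] that mesh_element(5)[OF m] by (auto simp: p_def Let_def)
  qed
  have "continuous_on (\<Union>T\<in>\<T>. T) p"
  proof (rule continuous_on_closed_Union)
    fix T assume T: "T \<in> \<T>"
    show "closed T" by (rule mesh_element[OF m T])
    have "continuous_on T (\<lambda>x. a T \<bullet> x + b T)" by (intro continuous_intros)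
    then show "continuous_on T p"
      using p[OF T] by (simp cong: continuous_on_cong)
  qed (rule mesh_finite[OF m])
  then have "pw_linear \<T> \<Omega> p"
    using p mesh_Union[OF m] unfolding pw_linear_def by (auto simp: image_ident)
  moreover have "p x = g x" if "x \<in> mesh_vertices \<T>" for x
    using that p ab by (force simp: mesh_vertices_def extreme_point_of_def)
  ultimately show ?thesis by (auto simp: p_def)
qed

text \<open>Existence and uniqueness turn the definite description in \<^const>\<open>nodal_interp\<close> into usable properties.\<close>

lemma nodal_interp:
  fixes \<Omega> :: "'a::euclidean_space set" and g :: "'a \<Rightarrow> real"
  assumes m: "mesh_of \<Omega> \<T>"
  shows "pw_linear \<T> \<Omega> (nodal_interp \<T> \<Omega> g)"
    and "x \<in> mesh_vertices \<T> \<Longrightarrow> nodal_interp \<T> \<Omega> g x = g x"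
    and "x \<notin> closure \<Omega> \<Longrightarrow> nodal_interp \<T> \<Omega> g x = 0"
proof -
  let ?P = "\<lambda>p. pw_linear \<T> \<Omega> p \<and> (\<forall>x\<in>mesh_vertices \<T>. p x = g x) \<and> (\<forall>x. x \<notin> closure \<Omega> \<longrightarrow> p x = 0)"
  have "\<exists>!p. ?P p"
  proof (rule ex_ex1I)
    show "\<exists>p. ?P p" by (rule ex_pw_linear_interpolant[OF m])
    show "p = q" if "?P p" "?P q" for p q
      using pw_linear_unique[OF m, of p q] that by (intro ext) metis
  qed
  then have "?P (nodal_interp \<T> \<Omega> g)"
    unfolding nodal_interp_def by (rule theI')
  then show "pw_linear \<T> \<Omega> (nodal_interp \<T> \<Omega> g)"
    "x \<in> mesh_vertices \<T> \<Longrightarrow> nodal_interp \<T> \<Omega> g x = g x"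
    "x \<notin> closure \<Omega> \<Longrightarrow> nodal_interp \<T> \<Omega> g x = 0" by auto
qed

text \<open>If \<open>x\<close> lies outside the open union, then so do all vertices that enter the barycentric representation of
\<open>x\<close> with positive weight, by \<open>mesh_star\<close>; the value at \<open>x\<close> is a combination of the values at these vertices.
This gives the Dirichlet condition for interpolants on subdomains.\<close>

lemma pw_linear_zero_off_union:
  fixes \<Omega> :: "'a::euclidean_space set"
  assumes m: "mesh_of \<Omega> \<T>" and E: "\<E> \<subseteq> \<T>" and p: "pw_linear \<T> \<Omega> p"
    and v: "\<And>x. x \<in> mesh_vertices \<T> \<Longrightarrow> x \<notin> interior (\<Union>\<E>) \<Longrightarrow> p x = 0"
    and x: "x \<in> closure \<Omega>" "x \<notin> interior (\<Union>\<E>)"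
  shows "p x = 0"
proof -
  obtain T where T: "T \<in> \<T>" "x \<in> T" using x mesh_Union[OF m] by auto
  obtain a b where ab: "\<And>x. x \<in> T \<Longrightarrow> p x = a \<bullet> x + b"
    using pw_linear_element[OF m p T(1)] by blast
  define C where "C = {c. c extreme_point_of T}"
  have fin: "finite C"
  proof -
    obtain B where "finite B" "T = convex hull B"
      using m T by (auto simp: mesh_of_def simplex)
    then show ?thesis
      unfolding C_def using extreme_points_of_convex_hull finite_subset by metis
  qed
  have "x \<in> convex hull C"
    using mesh_element_hull[OF m T(1)] T by (simp add: C_def)
  then obtain l where l: "\<And>c. c \<in> C \<Longrightarrow> 0 \<le> l c" "sum l C = 1" "(\<Sum>c\<in>C. l c *\<^sub>R c) = x"
    using fin by (auto simp: convex_hull_finite)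
  have CT: "c \<in> T" if "c \<in> C" for c
    using that by (simp add: C_def extreme_point_of_def)
  have zero: "l c * (a \<bullet> c + b) = 0" if c: "c \<in> C" for c
  proof (cases "l c = 0")
    case False
    then have lc: "l c > 0" using l(1)[OF c] by simp
    have "c \<notin> interior (\<Union>\<E>)"
    proof
      assume ci: "c \<in> interior (\<Union>\<E>)"
      have s1: "sum l (C - {c}) = 1 - l c"
        using l fin c by (simp add: sum_diff1)
      have "l c \<le> 1"
        using sum_nonneg[of "C - {c}" l] l(1) s1 by simp
      have xc: "x = l c *\<^sub>R c + (\<Sum>d\<in>C-{c}. l d *\<^sub>R d)"
        using l(3) sum.remove[OF fin c, of "\<lambda>c. l c *\<^sub>R c"] by simp
      have "l c < 1"
      proof (rule ccontr)
        assume "\<not> l c < 1"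
        then have "l c = 1" using \<open>l c \<le> 1\<close> by simp
        then have "\<forall>d\<in>C-{c}. l d = 0"
          using s1 sum_nonneg_eq_0_iff[of "C-{c}" l] fin l(1) by simp
        then have "x = c" using xc \<open>l c = 1\<close> by simp
        then show False using x ci by simp
      qed
      define f where "f = (\<Sum>d\<in>C-{c}. (l d / (1 - l c)) *\<^sub>R d)"
      have "f \<in> T"
        unfolding f_def
      proof (rule convex_sum)
        show "convex T" by (rule mesh_element[OF m T(1)])
        show "sum (\<lambda>d. l d / (1 - l c)) (C - {c}) = 1"
          using s1 \<open>l c < 1\<close> by (simp flip: sum_divide_distrib)
      qed (use fin l(1) CT \<open>l c < 1\<close> in auto)
      have xf: "x = (1 - (1 - l c)) *\<^sub>R c + (1 - l c) *\<^sub>R f"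
        using xc \<open>l c < 1\<close> by (simp add: f_def scaleR_sum_right)
      have "c \<noteq> f"
      proof
        assume "c = f"
        then have "x = c" using xf by (metis add.commute scaleR_left_distrib diff_add_cancel scaleR_one)
        then show False using x ci by simp
      qed
      then have "x \<in> open_segment c f"
        unfolding in_segment using xf lc \<open>l c < 1\<close>
        by (intro conjI exI[of _ "1 - l c"]) auto
      then show False
        using mesh_star[OF m E T(1) CT[OF c] ci \<open>f \<in> T\<close>] x by blast
    qed
    then have "p c = 0"
      using v extreme_point_mesh_vertex[OF T(1)] c by (auto simp: C_def)
    then show ?thesis using ab CT[OF c] by simp
  qed simp
  have "p x = a \<bullet> (\<Sum>c\<in>C. l c *\<^sub>R c) + b * sum l C"
    using ab T l by simp
  also have "\<dots> = (\<Sum>c\<in>C. l c * (a \<bullet> c + b))"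
    by (simp add: inner_sum_right sum_distrib_left sum.distrib[symmetric] algebra_simps)
  also have "\<dots> = 0" by (rule sum.neutral) (use zero in blast)
  finally show ?thesis .
qed

section \<open>Elementwise gradients and the energies\<close>

text \<open>The constant gradient on the element \<open>T\<close>; it is meaningful for functions that are affine on \<open>T\<close>.\<close>

definition egrad :: "'a::euclidean_space set \<Rightarrow> ('a \<Rightarrow> real) \<Rightarrow> 'a" where
  "egrad T u = (SOME a. \<exists>b. \<forall>x\<in>T. u x = a \<bullet> x + b)"

lemma affine_gradient_unique:
  fixes a a' :: "'a::euclidean_space"
  assumes "interior T \<noteq> {}" "\<forall>x\<in>T. a \<bullet> x + b = a' \<bullet> x + (b'::real)"
  shows "a = a'"
proof -
  obtain x where "x \<in> interior T" using assms by auto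
  then obtain e where e: "e > 0" "cball x e \<subseteq> T" by (auto simp: mem_interior_cball)
  show ?thesis
  proof (rule ccontr)
    assume ne: "a \<noteq> a'"
    define y where "y = x + (e / norm (a - a')) *\<^sub>R (a - a')"
    have "y \<in> T" "x \<in> T" using e ne by (auto simp: y_def dist_norm intro!: subsetD[OF e(2)])
    then have "a \<bullet> x + b = a' \<bullet> x + b'" "a \<bullet> y + b = a' \<bullet> y + b'"
      using assms(2) by blast+
    then have "(a - a') \<bullet> (y - x) = 0"
      by (simp add: inner_simps)
    then have "(e / norm (a - a')) * ((a - a') \<bullet> (a - a')) = 0"
      by (simp add: y_def)
    then show False using ne e by simp
  qed
qed

lemma egrad_eqI:
  assumes "interior T \<noteq> {}" "\<And>x. x \<in> T \<Longrightarrow> u x = a \<bullet> x + b"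
  shows "egrad T u = a"
proof -
  have "\<exists>b. \<forall>x\<in>T. u x = egrad T u \<bullet> x + b"
    unfolding egrad_def using assms(2) by (intro someI_ex[where P="\<lambda>a. \<exists>b. \<forall>x\<in>T. u x = a \<bullet> x + b"]) blast
  then show ?thesis
    using affine_gradient_unique[OF assms(1)] assms(2) by metis
qed

lemma pw_linear_egrad:
  assumes m: "mesh_of \<Omega> \<T>" and u: "pw_linear \<T> \<Omega> u" and T: "T \<in> \<T>"
  obtains b where "\<And>x. x \<in> T \<Longrightarrow> u x = egrad T u \<bullet> x + b"
proof -
  obtain a b where "\<And>x. x \<in> T \<Longrightarrow> u x = a \<bullet> x + b"
    using pw_linear_element[OF m u T] by blast
  moreover from this have "egrad T u = a" by (rule egrad_eqI[OF mesh_element(4)[OF m T]])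
  ultimately show ?thesis using that by blast
qed

lemma pw_linear_diff:
  assumes m: "mesh_of \<Omega> \<T>" and u: "pw_linear \<T> \<Omega> u" and T: "T \<in> \<T>" and "x \<in> T" "y \<in> T"
  shows "u x - u y = egrad T u \<bullet> (x - y)"
proof -
  obtain b where "\<And>x. x \<in> T \<Longrightarrow> u x = egrad T u \<bullet> x + b"
    using pw_linear_egrad[OF m u T] by blast
  then show ?thesis using assms by (simp add: inner_diff_right)
qed

lemma egrad_add_scaled:
  assumes m: "mesh_of \<Omega> \<T>" and u: "pw_linear \<T> \<Omega> u" and v: "pw_linear \<T> \<Omega> v" and T: "T \<in> \<T>"
  shows "egrad T (\<lambda>x. u x + t * v x) = egrad T u + t *\<^sub>R egrad T v"
proof -
  obtain b where b: "\<And>x. x \<in> T \<Longrightarrow> u x = egrad T u \<bullet> x + b"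
    using pw_linear_egrad[OF m u T] by blast
  obtain b' where b': "\<And>x. x \<in> T \<Longrightarrow> v x = egrad T v \<bullet> x + b'"
    using pw_linear_egrad[OF m v T] by blast
  show ?thesis
    by (rule egrad_eqI[OF mesh_element(4)[OF m T], where b="b + t * b'"])
      (simp add: b b' inner_simps algebra_simps)
qed

lemma grad_eq_egrad:
  assumes m: "mesh_of \<Omega> \<T>" and u: "pw_linear \<T> \<Omega> u" and T: "T \<in> \<T>" and x: "x \<in> interior T"
  shows "grad u x = egrad T u"
proof -
  obtain b where b: "\<And>x. x \<in> T \<Longrightarrow> u x = egrad T u \<bullet> x + b"
    using pw_linear_egrad[OF m u T] by blast
  have "((\<lambda>x. egrad T u \<bullet> x + b) has_derivative (\<lambda>h. h \<bullet> egrad T u)) (at x)"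
    by (auto intro!: derivative_eq_intros simp: inner_commute)
  then have "(u has_derivative (\<lambda>h. h \<bullet> egrad T u)) (at x)"
    by (rule has_derivative_transform_within_open[OF _ open_interior x])
      (metis b interior_subset subsetD)
  then have g: "GDERIV u x :> egrad T u" by (simp add: gderiv_def)
  show ?thesis
    unfolding grad_def
  proof (rule the_equality)
    show "GDERIV u x :> egrad T u" by (rule g)
    fix g assume "GDERIV u x :> g"
    then have "(\<lambda>h. h \<bullet> g) = (\<lambda>h. h \<bullet> egrad T u)"
      using g unfolding gderiv_def by (rule has_derivative_unique)
    then show "g = egrad T u"
      by (metis inner_commute vector_eq_rdot)
  qed
qed

lemma AE_mesh_interior:
  assumes m: "mesh_of \<Omega> \<T>"
  shows "AE x in lebesgue. \<forall>T\<in>\<T>. x \<in> T \<longrightarrow> x \<in> interior T"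
proof -
  have "AE x in lebesgue. x \<in> T \<longrightarrow> x \<in> interior T" if T: "T \<in> \<T>" for T
  proof -
    have "frontier T \<in> null_sets lebesgue"
      using negligible_convex_frontier[OF mesh_element(1)[OF m T]] negligible_iff_null_sets by blast
    then have "AE x in lebesgue. x \<notin> frontier T" by (rule AE_not_in)
    then show ?thesis
      using mesh_element(3)[OF m T] by (auto simp: frontier_def closure_closed)
  qed
  then show ?thesis
    by (simp add: AE_finite_all[OF mesh_finite[OF m]])
qed

lemma sum_indicator_mesh:
  fixes f :: "'a::euclidean_space set \<Rightarrow> real"
  assumes m: "mesh_of \<Omega> \<T>" and x: "\<forall>T\<in>\<T>. x \<in> T \<longrightarrow> x \<in> interior T" and T: "T \<in> \<T>" "x \<in> T"
  shows "(\<Sum>S\<in>\<T>. indicator S x * f S) = f T"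
proof -
  have "(\<Sum>S\<in>\<T>. indicator S x * f S) = (\<Sum>S\<in>\<T>. if S = T then f S else 0)"
  proof (rule sum.cong[OF refl])
    fix S assume S: "S \<in> \<T>"
    show "indicator S x * f S = (if S = T then f S else 0)"
      using mesh_interior_disjoint[OF m T(1) S] x T S by (auto simp: indicator_def)
  qed
  then show ?thesis using T mesh_finite[OF m] by simp
qed

text \<open>Element boundaries are null sets, so almost every point of \<open>\<Omega>\<close> is interior to exactly one element.
Regularity of \<open>\<Omega>\<close> guarantees that the open elements do not stick out of \<open>\<Omega>\<close>.\<close>

lemma AE_grad_eq_sum:
  fixes \<Omega> :: "'a::euclidean_space set" and f :: "'a \<Rightarrow> real"
  assumes m: "mesh_of \<Omega> \<T>" and r: "interior (closure \<Omega>) = \<Omega>" and u: "pw_linear \<T> \<Omega> u"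
  shows "AE x in lebesgue. indicator \<Omega> x * f (grad u x) = (\<Sum>T\<in>\<T>. indicator T x * f (egrad T u))"
  using AE_mesh_interior[OF m]
proof (rule AE_mp, intro AE_I2 impI)
  fix x assume x: "\<forall>T\<in>\<T>. x \<in> T \<longrightarrow> x \<in> interior T"
  show "indicator \<Omega> x * f (grad u x) = (\<Sum>T\<in>\<T>. indicator T x * f (egrad T u))"
  proof (cases "\<exists>T\<in>\<T>. x \<in> T")
    case True
    then obtain T where T: "T \<in> \<T>" "x \<in> T" by auto
    then have xi: "x \<in> interior T" using x by auto
    then have "x \<in> \<Omega>"
      using interior_mono[OF mesh_element(5)[OF m T(1)]] r by auto
    then show ?thesis
      using sum_indicator_mesh[OF m x T, of "\<lambda>T. f (egrad T u)"] grad_eq_egrad[OF m u T(1) xi] by simp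
  next
    case False
    then have "x \<notin> \<Omega>" using mesh_Union[OF m] closure_subset[of \<Omega>] by blast
    then show ?thesis using False by (auto intro!: sum.neutral[symmetric])
  qed
qed

lemma integral_grad:
  fixes \<Omega> :: "'a::euclidean_space set" and f :: "'a \<Rightarrow> real"
  assumes m: "mesh_of \<Omega> \<T>" and r: "interior (closure \<Omega>) = \<Omega>" and u: "pw_linear \<T> \<Omega> u"
  shows "(LINT x:\<Omega>|lebesgue. f (grad u x)) = (\<Sum>T\<in>\<T>. measure lebesgue T * f (egrad T u))"
proof -
  have lm: "T \<in> lmeasurable" if "T \<in> \<T>" for T
    using mesh_element(2)[OF m that] by (rule lmeasurable_compact)
  then have i: "integrable lebesgue (\<lambda>x. indicator T x * f (egrad T u))" if "T \<in> \<T>" for T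
    using lm[OF that] by (intro integrable_mult_left integrable_real_indicator)
      (auto simp: fmeasurable_def)
  have AE: "AE x in lebesgue. (\<Sum>T\<in>\<T>. indicator T x * f (egrad T u)) = indicator \<Omega> x * f (grad u x)"
    using AE_grad_eq_sum[OF m r u, of f] by (auto elim: AE_mp)
  have meas: "(\<lambda>x. \<Sum>T\<in>\<T>. indicator T x * f (egrad T u)) \<in> borel_measurable lebesgue"
    using i by (intro borel_measurable_sum borel_measurable_integrable) blast
  have "(LINT x:\<Omega>|lebesgue. f (grad u x)) = (LINT x|lebesgue. indicator \<Omega> x * f (grad u x))"
    by (simp add: set_lebesgue_integral_def)
  also have "\<dots> = (LINT x|lebesgue. (\<Sum>T\<in>\<T>. indicator T x * f (egrad T u)))"
    using borel_measurable_AE[OF meas AE] meas AE by (intro integral_cong_AE) auto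
  also have "\<dots> = (\<Sum>T\<in>\<T>. (LINT x|lebesgue. indicator T x * f (egrad T u)))"
    using i by (rule Bochner_Integration.integral_sum)
  also have "\<dots> = (\<Sum>T\<in>\<T>. measure lebesgue T * f (egrad T u))"
    by (simp add: integral_mult_left_zero)
  finally show ?thesis .
qed

definition energy :: "'a::euclidean_space set set \<Rightarrow> ('a \<Rightarrow> real) \<Rightarrow> real" where
  "energy \<T> u = (\<Sum>T\<in>\<T>. measure lebesgue T * (norm (egrad T u))\<^sup>2)"

lemma energy_nonneg: "0 \<le> energy \<T> u"
  unfolding energy_def by (intro sum_nonneg mult_nonneg_nonneg) auto

lemma H1_seminorm_energy:
  assumes "mesh_of \<Omega> \<T>" "interior (closure \<Omega>) = \<Omega>" "pw_linear \<T> \<Omega> u"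
  shows "(H1_seminorm \<Omega> u)\<^sup>2 = energy \<T> u"
  using integral_grad[OF assms, of "\<lambda>g. (norm g)\<^sup>2"] energy_nonneg[of \<T> u]
  by (simp add: H1_seminorm_def energy_def)

text \<open>Along the line \<open>v + t w\<close> the functional \<open>F_h\<close> is a quadratic polynomial in \<open>t\<close>; the Bregman distance
removes its constant and linear terms.\<close>

lemma bregman_F_h:
  assumes m: "mesh_of \<Omega> \<T>" and r: "interior (closure \<Omega>) = \<Omega>"
    and v: "pw_linear \<T> \<Omega> v" and w: "pw_linear \<T> \<Omega> w"
  shows "bregman (F_h \<Omega>) (\<lambda>x. v x + w x) v = energy \<T> w / 2"
proof -
  define A where "A = (\<Sum>T\<in>\<T>. measure lebesgue T * (norm (egrad T v))\<^sup>2 / 2)"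
  define B where "B = (\<Sum>T\<in>\<T>. measure lebesgue T * (egrad T v \<bullet> egrad T w))"
  have *: "F_h \<Omega> (\<lambda>x. v x + t * w x) = A + t * B + t\<^sup>2 * (energy \<T> w / 2)" for t
  proof -
    have "pw_linear \<T> \<Omega> (\<lambda>x. v x + t * w x)"
      using pw_linear_lincomb[OF v w, of 1 t] by simp
    then have "F_h \<Omega> (\<lambda>x. v x + t * w x)
        = (\<Sum>T\<in>\<T>. measure lebesgue T * (1/2 * (norm (egrad T v + t *\<^sub>R egrad T w))\<^sup>2))"
      unfolding F_h_def
      using integral_grad[OF m r, of _ "\<lambda>g. 1/2 * (norm g)\<^sup>2"] egrad_add_scaled[OF m v w] by simp
    also have "\<dots> = (\<Sum>T\<in>\<T>. measure lebesgue T * (norm (egrad T v))\<^sup>2 / 2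
        + t * (measure lebesgue T * (egrad T v \<bullet> egrad T w))
        + t\<^sup>2 * (measure lebesgue T * (norm (egrad T w))\<^sup>2 / 2))"
      by (rule sum.cong[OF refl], simp only: power2_norm_eq_inner)
        (simp add: inner_simps inner_commute power2_eq_square algebra_simps)
    finally show ?thesis
      by (simp add: A_def B_def energy_def sum.distrib sum_distrib_left sum_divide_distrib)
  qed
  have "((\<lambda>t. A + t * B + t\<^sup>2 * (energy \<T> w / 2)) has_field_derivative B) (at 0)"
    by (auto intro!: derivative_eq_intros)
  then have "deriv (\<lambda>t. F_h \<Omega> (\<lambda>x. v x + t * w x)) 0 = B"
    unfolding * by (rule DERIV_imp_deriv)
  then show ?thesis
    using *[of 1] *[of 0] by (simp add: bregman_def)
qed

lemma pw_linear_set_integrable: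
  assumes b: "bounded \<Omega>" "open \<Omega>" and u: "pw_linear \<T> \<Omega> u"
  shows "set_integrable lebesgue \<Omega> u"
proof -
  have "compact (closure \<Omega>)" using b by simp
  then have "integrable lborel (\<lambda>x. indicator (closure \<Omega>) x *\<^sub>R u x)"
    using u by (intro borel_integrable_compact) (auto simp: pw_linear_def)
  then have "set_integrable lebesgue (closure \<Omega>) u"
    unfolding set_integrable_def by (subst integrable_completion) auto
  then show ?thesis
    by (rule set_integrable_subset) (use b closure_subset in auto)
qed

text \<open>Both sides are integrals of continuous piecewise linear functions, for which an inequality at the
vertices extends to the whole domain.\<close>

lemma G_h_sum_le:
  fixes \<Omega> :: "'a::euclidean_space set" and U :: "nat \<Rightarrow> 'a \<Rightarrow> real"
  assumes m: "mesh_of \<Omega> \<T>" and b: "bounded \<Omega>" "open \<Omega>"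
    and le: "\<And>x. x \<in> mesh_vertices \<T> \<Longrightarrow>
      (\<Sum>k\<in>I. \<phi> x (U k x)) \<le> \<phi> x (u x) + c * \<phi> x (v x)"
  shows "(\<Sum>k\<in>I. G_h \<T> \<Omega> \<phi> (U k)) \<le> G_h \<T> \<Omega> \<phi> u + c * G_h \<T> \<Omega> \<phi> v"
proof -
  let ?J = "\<lambda>u. nodal_interp \<T> \<Omega> (\<lambda>y. \<phi> y (u y))"
  note J = nodal_interp(1)[OF m]
  note I = pw_linear_set_integrable[OF b]
  have pw: "pw_linear \<T> \<Omega> (\<lambda>x. ?J u x + c * ?J v x)"
    using pw_linear_lincomb[OF J J, of 1 _ c] by simp
  have pws: "pw_linear \<T> \<Omega> (\<lambda>x. \<Sum>k\<in>I. ?J (U k) x)"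
    by (rule pw_linear_sum[OF J])
  have *: "(\<Sum>k\<in>I. ?J (U k) x) \<le> ?J u x + c * ?J v x" if "x \<in> closure \<Omega>" for x
    using pw_linear_nonneg[OF m pw_linear_lincomb[OF pw pws, of 1 "-1"] _ that] le
    by (simp add: nodal_interp(2)[OF m])
  have "(\<Sum>k\<in>I. G_h \<T> \<Omega> \<phi> (U k)) = (LINT x:\<Omega>|lebesgue. (\<Sum>k\<in>I. ?J (U k) x))"
    unfolding G_h_def set_lebesgue_integral_def scaleR_sum_right
    using I[OF J] by (intro Bochner_Integration.integral_sum[symmetric]) (auto simp: set_integrable_def)
  also have "\<dots> \<le> (LINT x:\<Omega>|lebesgue. ?J u x + c * ?J v x)"
    using * closure_subset by (intro set_integral_mono I[OF pw] I[OF pws]) blast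
  also have "\<dots> = G_h \<T> \<Omega> \<phi> u + c * G_h \<T> \<Omega> \<phi> v"
    using set_integral_add(2)[OF I[OF J] set_integrable_mult_right, of c, OF I[OF J]]
    by (simp add: G_h_def)
  finally show ?thesis .
qed

section \<open>Difference quotients along lines and the Friedrichs inequality\<close>

text \<open>An everywhere defined Borel version of \<open>|\<nabla>u|\<^sup>2\<close>. On element boundaries it adds up the contributions of
all adjacent elements, so that it dominates each one-sided gradient there.\<close>

definition grad_sq :: "'a::euclidean_space set set \<Rightarrow> ('a \<Rightarrow> real) \<Rightarrow> 'a \<Rightarrow> real" where
  "grad_sq \<T> u x = (\<Sum>T\<in>\<T>. indicator T x * (norm (egrad T u))\<^sup>2)"

lemma grad_sq_nonneg: "0 \<le> grad_sq \<T> u x"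
  unfolding grad_sq_def by (intro sum_nonneg mult_nonneg_nonneg) auto

lemma grad_sq_ge:
  assumes "finite \<T>" "T \<in> \<T>" "x \<in> T"
  shows "(norm (egrad T u))\<^sup>2 \<le> grad_sq \<T> u x"
proof -
  have "(norm (egrad T u))\<^sup>2 = indicator T x * (norm (egrad T u))\<^sup>2" using assms by simp
  also have "\<dots> \<le> grad_sq \<T> u x"
    unfolding grad_sq_def using assms by (intro member_le_sum) auto
  finally show ?thesis .
qed

lemma grad_sq_measurable:
  assumes m: "mesh_of \<Omega> \<T>"
  shows "grad_sq \<T> u \<in> borel_measurable borel"
proof -
  have "T \<in> sets borel" if "T \<in> \<T>" for T
    using mesh_element(3)[OF m that] by simp
  then show ?thesis
    unfolding grad_sq_def[abs_def] by (intro borel_measurable_sum borel_measurable_times) auto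
qed

lemma fe_space_continuous:
  assumes u: "u \<in> fe_space \<T> \<Omega>" and o: "open \<Omega>"
  shows "continuous_on UNIV u"
proof -
  have "continuous_on (closure \<Omega> \<union> - \<Omega>) u"
  proof (rule continuous_on_closed_Un)
    show "continuous_on (closure \<Omega>) u" using u by (simp add: fe_space_def pw_linear_def)
    have "continuous_on (- \<Omega>) (\<lambda>x. 0::real)" by simp
    then show "continuous_on (- \<Omega>) u"
      by (rule continuous_on_eq) (use u in \<open>simp add: fe_space_def\<close>)
  qed (use o in auto)
  moreover have "closure \<Omega> \<union> - \<Omega> = UNIV" using closure_subset by auto
  ultimately show ?thesis by simp
qed

text \<open>A line meets an element in a compact interval, whose at most two end points can be exempted in the
fundamental theorem of calculus.\<close>

lemma line_meets_element:
  fixes z :: "'a::euclidean_space"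
  assumes T: "convex T" "compact T" and z: "z \<noteq> 0"
  shows "finite (frontier {t::real. y + t *\<^sub>R z \<in> T})" "closed {t::real. y + t *\<^sub>R z \<in> T}"
proof -
  let ?I = "{t::real. y + t *\<^sub>R z \<in> T}"
  have c: "closed ?I"
  proof -
    have "continuous_on UNIV (\<lambda>t::real. y + t *\<^sub>R z)" by (intro continuous_intros)
    then have "closed ((\<lambda>t::real. y + t *\<^sub>R z) -` T)"
      using compact_imp_closed[OF T(2)] by (simp add: continuous_on_closed_vimage)
    then show ?thesis by (simp add: vimage_def)
  qed
  have "convex ?I"
  proof (rule convexI)
    fix s t u v :: real assume st: "s \<in> ?I" "t \<in> ?I" and uv: "0 \<le> u" "0 \<le> v" "u + v = 1"
    have "u *\<^sub>R (y + s *\<^sub>R z) + v *\<^sub>R (y + t *\<^sub>R z) \<in> T"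
      using st uv T(1) by (auto intro: convexD)
    moreover have "u *\<^sub>R (y + s *\<^sub>R z) + v *\<^sub>R (y + t *\<^sub>R z) = (u + v) *\<^sub>R y + (u * s + v * t) *\<^sub>R z"
      by (simp add: algebra_simps)
    ultimately show "u *\<^sub>R s + v *\<^sub>R t \<in> ?I" using uv by simp
  qed
  moreover have "compact ?I"
  proof -
    obtain B where B: "\<And>x. x \<in> T \<Longrightarrow> norm x \<le> B"
      using compact_imp_bounded[OF T(2)] by (auto simp: bounded_iff)
    have "norm t \<le> (B + norm y) / norm z" if "t \<in> ?I" for t
    proof -
      have "norm (t *\<^sub>R z) \<le> norm (y + t *\<^sub>R z) + norm y"
        using norm_triangle_ineq4[of "y + t *\<^sub>R z" y] by simp
      also have "\<dots> \<le> B + norm y" using B that by auto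
      finally show ?thesis using z by (simp add: pos_le_divide_eq)
    qed
    then have "bounded ?I" by (meson boundedI)
    then show ?thesis using c by (simp add: compact_eq_bounded_closed)
  qed
  ultimately obtain p q where "?I = {p..q}"
    using connected_compact_interval_1[of ?I] convex_connected by blast
  moreover have "frontier {p..q} \<subseteq> {p, q}"
    by (auto simp: frontier_def closure_closed)
  ultimately show "finite (frontier ?I)" by (metis finite.emptyI finite.insertI finite_subset)
  show "closed ?I" by (rule c)
qed

text \<open>Along a line, \<open>u\<close> is continuous and affine between finitely many break points; off the mesh it vanishes.
Between break points the slope is the inner product of \<open>z\<close> with the gradient on some element, and
\<^const>\<open>grad_sq\<close> bounds it even if the line runs inside a common face of several elements.\<close>

lemma line_estimate_real:
  fixes \<Omega> :: "'a::euclidean_space set"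
  assumes m: "mesh_of \<Omega> \<T>" and o: "open \<Omega>" and u: "u \<in> fe_space \<T> \<Omega>" and ab: "a < b"
    and z: "z \<noteq> 0"
  shows "set_integrable lborel {a..b} (\<lambda>t. grad_sq \<T> u (y + t *\<^sub>R z))"
    and "(u (y + b *\<^sub>R z) - u (y + a *\<^sub>R z))\<^sup>2
      \<le> (b - a) * (norm z)\<^sup>2 * (LINT t:{a..b}|lborel. grad_sq \<T> u (y + t *\<^sub>R z))"
proof -
  define J where "J T = {t. y + t *\<^sub>R z \<in> T}" for T
  define p where "p t = u (y + t *\<^sub>R z)" for t
  define q where "q t = grad_sq \<T> u (y + t *\<^sub>R z)" for t
  define p' where "p' t = (if \<exists>T\<in>\<T>. t \<in> interior (J T)
      then egrad (SOME T. T \<in> \<T> \<and> t \<in> interior (J T)) u \<bullet> z else 0)" for t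
  have pw: "pw_linear \<T> \<Omega> u" and u0: "\<And>x. x \<notin> \<Omega> \<Longrightarrow> u x = 0"
    using u by (auto simp: fe_space_def)
  have cJ: "closed (J T)" "finite (frontier (J T))" if "T \<in> \<T>" for T
    using line_meets_element[OF mesh_element(1,2)[OF m that] z, of y] by (auto simp: J_def)
  have q_eq: "q t = (\<Sum>T\<in>\<T>. indicator (J T) t * (norm (egrad T u))\<^sup>2)" for t
    unfolding q_def grad_sq_def by (rule sum.cong) (auto simp: J_def indicator_def)
  have int: "set_integrable lborel {a..b} q"
    unfolding set_integrable_def q_eq scaleR_sum_right
  proof (rule Bochner_Integration.integrable_sum)
    fix T assume T: "T \<in> \<T>"
    have "integrable lborel (indicator (J T \<inter> {a..b}) :: real \<Rightarrow> real)"
    proof (rule integrable_real_indicator)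
      have "emeasure lborel (J T \<inter> {a..b}) \<le> emeasure lborel {a..b}"
        by (rule emeasure_mono) auto
      also have "\<dots> < \<infinity>" using ab by simp
      finally show "emeasure lborel (J T \<inter> {a..b}) < \<infinity>" .
    qed (use cJ(1)[OF T] in auto)
    then have "integrable lborel (\<lambda>t. indicator (J T \<inter> {a..b}) t * (norm (egrad T u))\<^sup>2)"
      by (rule integrable_mult_left)
    then show "integrable lborel (\<lambda>x. indicator {a..b} x *\<^sub>R (indicator (J T) x * (norm (egrad T u))\<^sup>2))"
      by (simp add: indicator_inter_arith mult_ac)
  qed
  then show "set_integrable lborel {a..b} (\<lambda>t. grad_sq \<T> u (y + t *\<^sub>R z))"
    unfolding q_def[abs_def] .
  have q_int: "(q has_integral (LINT t:{a..b}|lborel. q t)) {a..b}"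
    unfolding set_borel_integral_eq_integral(2)[OF int]
    by (rule integrable_integral[OF set_borel_integral_eq_integral(1)[OF int]])
  have p'_int: "(p' has_integral (p b - p a)) {a..b}"
  proof (rule fundamental_theorem_of_calculus_interior_strong[where S="\<Union>T\<in>\<T>. frontier (J T)"])
    show "finite (\<Union>T\<in>\<T>. frontier (J T))"
      using cJ(2) mesh_finite[OF m] by auto
    show "continuous_on {a..b} p"
    proof -
      have "continuous_on UNIV p"
        unfolding p_def
        by (rule continuous_on_compose2[OF fe_space_continuous[OF u o]]) (auto intro!: continuous_intros)
      then show ?thesis by (rule continuous_on_subset) auto
    qed
    fix t assume t: "t \<in> {a<..<b} - (\<Union>T\<in>\<T>. frontier (J T))"
    show "(p has_vector_derivative p' t) (at t)"
    proof (cases "\<exists>T\<in>\<T>. t \<in> interior (J T)")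
      case True
      define T where "T = (SOME T. T \<in> \<T> \<and> t \<in> interior (J T))"
      have T: "T \<in> \<T>" "t \<in> interior (J T)"
        using someI_ex[of "\<lambda>T. T \<in> \<T> \<and> t \<in> interior (J T)"] True unfolding T_def by blast+
      obtain c where c: "\<And>x. x \<in> T \<Longrightarrow> u x = egrad T u \<bullet> x + c"
        using pw_linear_egrad[OF m pw T(1)] by blast
      have "((\<lambda>t. egrad T u \<bullet> (y + t *\<^sub>R z) + c) has_vector_derivative p' t) (at t)"
      proof -
        have "p' t = egrad T u \<bullet> z" using True by (simp add: p'_def T_def)
        moreover have "((\<lambda>t. egrad T u \<bullet> (y + t *\<^sub>R z) + c) has_real_derivative egrad T u \<bullet> z) (at t)"
          unfolding inner_add_right inner_scaleR_right by (auto intro!: derivative_eq_intros)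
        ultimately show ?thesis by (simp add: has_real_derivative_iff_has_vector_derivative)
      qed
      then show ?thesis
      proof (rule has_vector_derivative_transform_within_open[OF _ open_interior T(2)])
        fix s assume "s \<in> interior (J T)"
        then have "s \<in> J T" using interior_subset by blast
        then show "egrad T u \<bullet> (y + s *\<^sub>R z) + c = p s" using c by (simp add: p_def J_def)
      qed
    next
      case False
      have nJ: "t \<notin> \<Union>(J ` \<T>)"
        using t False cJ(1) by (auto simp: frontier_def closure_closed)
      have "closed (\<Union>(J ` \<T>))"
        using cJ(1) mesh_finite[OF m] by auto
      then have "open (- \<Union>(J ` \<T>))" by (rule open_Compl)
      have "((\<lambda>t. 0) has_vector_derivative p' t) (at t)"
        using False by (simp add: p'_def)
      then show ?thesis
      proof (rule has_vector_derivative_transform_within_open[OF _ \<open>open (- \<Union>(J ` \<T>))\<close>])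
        show "t \<in> - \<Union>(J ` \<T>)" using nJ by blast
        fix s assume "s \<in> - \<Union>(J ` \<T>)"
        then have "y + s *\<^sub>R z \<notin> closure \<Omega>" using mesh_Union[OF m] by (auto simp: J_def)
        then have "y + s *\<^sub>R z \<notin> \<Omega>" using closure_subset by blast
        then show "0 = p s" using u0 by (simp add: p_def)
      qed
    qed
  qed (use ab in auto)
  have p'_le: "(p' t)\<^sup>2 \<le> (norm z)\<^sup>2 * q t" for t
  proof (cases "\<exists>T\<in>\<T>. t \<in> interior (J T)")
    case True
    define T where "T = (SOME T. T \<in> \<T> \<and> t \<in> interior (J T))"
    have T: "T \<in> \<T>" "t \<in> interior (J T)"
      using someI_ex[of "\<lambda>T. T \<in> \<T> \<and> t \<in> interior (J T)"] True unfolding T_def by blast+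
    then have "y + t *\<^sub>R z \<in> T" using interior_subset by (auto simp: J_def)
    have "(p' t)\<^sup>2 = (egrad T u \<bullet> z)\<^sup>2" using True by (simp add: p'_def T_def)
    also have "\<dots> \<le> (norm (egrad T u))\<^sup>2 * (norm z)\<^sup>2"
      using Cauchy_Schwarz_ineq[of "egrad T u" z] by (simp add: power2_norm_eq_inner)
    also have "\<dots> \<le> q t * (norm z)\<^sup>2"
      unfolding q_def using grad_sq_ge[OF mesh_finite[OF m] T(1) \<open>y + t *\<^sub>R z \<in> T\<close>]
      by (intro mult_right_mono) auto
    finally show ?thesis by (simp add: mult.commute)
  next
    case False
    then show ?thesis by (simp add: p'_def q_def grad_sq_nonneg)
  qed
  define I where "I = (LINT t:{a..b}|lborel. q t)"
  define c where "c = (p b - p a) / (b - a)"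
  \<comment> \<open>Cauchy-Schwarz in the form \<open>2 c p' \<le> c\<^sup>2 + p'\<^sup>2\<close> with the optimal constant \<open>c\<close>.\<close>
  have "((\<lambda>t. 2 * c * p' t) has_integral (2 * c * (p b - p a))) {a..b}"
    by (rule has_integral_mult_right[OF p'_int])
  moreover have "((\<lambda>t. c\<^sup>2 + (norm z)\<^sup>2 * q t) has_integral ((b - a) * c\<^sup>2 + (norm z)\<^sup>2 * I)) {a..b}"
    using has_integral_const_real[of "c\<^sup>2" a b] ab
    by (intro has_integral_add has_integral_mult_right q_int[folded I_def]) simp
  ultimately have "2 * c * (p b - p a) \<le> (b - a) * c\<^sup>2 + (norm z)\<^sup>2 * I"
  proof (rule has_integral_le)
    fix t
    have "0 \<le> (c - p' t)\<^sup>2" by simp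
    then have "2 * c * p' t \<le> c\<^sup>2 + (p' t)\<^sup>2" by (simp add: power2_diff)
    then show "2 * c * p' t \<le> c\<^sup>2 + (norm z)\<^sup>2 * q t" using p'_le[of t] by simp
  qed
  moreover have "p b - p a = c * (b - a)" using ab by (simp add: c_def)
  ultimately have "(b - a) * c\<^sup>2 \<le> (norm z)\<^sup>2 * I"
    by (simp add: power2_eq_square algebra_simps)
  then have "(b - a) * ((b - a) * c\<^sup>2) \<le> (b - a) * ((norm z)\<^sup>2 * I)"
    using ab by (intro mult_left_mono) auto
  then show "(u (y + b *\<^sub>R z) - u (y + a *\<^sub>R z))\<^sup>2
      \<le> (b - a) * (norm z)\<^sup>2 * (LINT t:{a..b}|lborel. grad_sq \<T> u (y + t *\<^sub>R z))"
    using \<open>p b - p a = c * (b - a)\<close> by (simp add: p_def I_def q_def power2_eq_square mult_ac)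
qed

lemma line_estimate:
  fixes \<Omega> :: "'a::euclidean_space set"
  assumes m: "mesh_of \<Omega> \<T>" and o: "open \<Omega>" and u: "u \<in> fe_space \<T> \<Omega>" and ab: "a \<le> b"
  shows "ennreal ((u (y + b *\<^sub>R z) - u (y + a *\<^sub>R z))\<^sup>2)
    \<le> ennreal ((b - a) * (norm z)\<^sup>2)
      * (\<integral>\<^sup>+t. indicator {a..b} t * ennreal (grad_sq \<T> u (y + t *\<^sub>R z)) \<partial>lborel)"
proof (cases "a < b \<and> z \<noteq> 0")
  case True
  note L = line_estimate_real[OF m o u, of a b z y]
  have "(\<integral>\<^sup>+t. indicator {a..b} t * ennreal (grad_sq \<T> u (y + t *\<^sub>R z)) \<partial>lborel)
     = (\<integral>\<^sup>+t. ennreal (indicator {a..b} t *\<^sub>R grad_sq \<T> u (y + t *\<^sub>R z)) \<partial>lborel)"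
    by (intro nn_integral_cong) (auto simp: indicator_def)
  also have "\<dots> = ennreal (LINT t:{a..b}|lborel. grad_sq \<T> u (y + t *\<^sub>R z))"
    unfolding set_lebesgue_integral_def
    using L(1) True by (intro nn_integral_eq_integral) (auto simp: set_integrable_def grad_sq_nonneg)
  finally show ?thesis
    using L(2) True by (simp add: ennreal_mult'[symmetric] ennreal_leI)
next
  case False
  then have "a = b \<or> z = 0" using ab by auto
  then show ?thesis by auto
qed

text \<open>Translating by a vector \<open>z\<close> of length \<open>R\<close> moves every point of \<open>\<Omega>\<close> out of \<open>\<Omega>\<close>, where \<open>u\<close> vanishes. Then
\<open>u(x)\<^sup>2\<close> is bounded by \<open>R\<^sup>2\<close> times the mean of \<^const>\<open>grad_sq\<close> over the segment from \<open>x\<close> to \<open>x + z\<close>, and the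
integral over \<open>x\<close> is translation invariant.\<close>

lemma friedrichs_inequality:
  fixes \<Omega> :: "'a::euclidean_space set"
  assumes m: "mesh_of \<Omega> \<T>" and o: "open \<Omega>" and b: "bounded \<Omega>" and u: "u \<in> fe_space \<T> \<Omega>"
    and R: "diameter \<Omega> < R"
  shows "(\<integral>\<^sup>+x. ennreal ((u x)\<^sup>2) \<partial>lborel)
    \<le> ennreal (R\<^sup>2) * (\<integral>\<^sup>+x. ennreal (grad_sq \<T> u x) \<partial>lborel)"
proof -
  have R0: "R > 0" using R diameter_ge_0[OF b] by linarith
  obtain z :: 'a where z: "norm z = R"
    using R0 vector_choose_size[of R] by auto
  define Q where "Q x = ennreal (grad_sq \<T> u x)" for x
  have [measurable]: "Q \<in> borel_measurable borel"
    unfolding Q_def using grad_sq_measurable[OF m] by measurable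
  have pt: "ennreal ((u x)\<^sup>2) \<le> ennreal (R\<^sup>2) * (\<integral>\<^sup>+t. indicator {0..1} t * Q (x + t *\<^sub>R z) \<partial>lborel)"
    for x
  proof (cases "x \<in> \<Omega>")
    case True
    have "x + z \<notin> \<Omega>"
    proof
      assume "x + z \<in> \<Omega>"
      then have "dist (x + z) x \<le> diameter \<Omega>" using diameter_bounded_bound[OF b _ True] by blast
      then show False using z R by (simp add: dist_norm)
    qed
    then have "u (x + z) = 0" using u by (simp add: fe_space_def)
    then show ?thesis
      using line_estimate[OF m o u, of 0 1 x z] z by (simp add: Q_def)
  next
    case False
    then show ?thesis using u by (simp add: fe_space_def)
  qed
  have "(\<integral>\<^sup>+x. ennreal ((u x)\<^sup>2) \<partial>lborel)
      \<le> (\<integral>\<^sup>+x. ennreal (R\<^sup>2) * (\<integral>\<^sup>+t. indicator {0..1} t * Q (x + t *\<^sub>R z) \<partial>lborel) \<partial>lborel)"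
    by (intro nn_integral_mono pt)
  also have "\<dots> = ennreal (R\<^sup>2) * (\<integral>\<^sup>+x. (\<integral>\<^sup>+t. indicator {0..1} t * Q (x + t *\<^sub>R z) \<partial>lborel) \<partial>lborel)"
    by (rule nn_integral_cmult) measurable
  also have "(\<integral>\<^sup>+x. (\<integral>\<^sup>+t. indicator {0..1::real} t * Q (x + t *\<^sub>R z) \<partial>lborel) \<partial>lborel)
      = (\<integral>\<^sup>+t. (\<integral>\<^sup>+x. indicator {0..1::real} t * Q (x + t *\<^sub>R z) \<partial>lborel) \<partial>lborel)"
    by (rule lborel_pair.Fubini'[symmetric]) measurable
  also have "\<dots> = (\<integral>\<^sup>+t. indicator {0..1::real} t * (\<integral>\<^sup>+x. Q x \<partial>lborel) \<partial>lborel)"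
  proof (rule nn_integral_cong)
    fix t :: real
    have "(\<integral>\<^sup>+x. Q x \<partial>lborel) = (\<integral>\<^sup>+x. Q x \<partial>distr lborel borel ((+) (t *\<^sub>R z)))"
      by (simp add: lborel_distr_plus)
    also have "\<dots> = (\<integral>\<^sup>+x. Q (x + t *\<^sub>R z) \<partial>lborel)"
      by (subst nn_integral_distr) (auto simp: add.commute)
    finally show "(\<integral>\<^sup>+x. indicator {0..1} t * Q (x + t *\<^sub>R z) \<partial>lborel)
        = indicator {0..1} t * (\<integral>\<^sup>+x. Q x \<partial>lborel)"
      by (simp add: nn_integral_cmult)
  qed
  also have "\<dots> = (\<integral>\<^sup>+x. Q x \<partial>lborel)"
    by (simp add: nn_integral_multc)
  finally show ?thesis by (simp add: Q_def)
qed

section \<open>Boundary layers of coarse elements\<close>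

lemma nn_integral_dilation_le:
  fixes g :: "'a::euclidean_space \<Rightarrow> ennreal"
  assumes g [measurable]: "g \<in> borel_measurable borel" and c: "1/2 \<le> c"
  shows "(\<integral>\<^sup>+x. g (x0 + c *\<^sub>R (x - x0)) \<partial>lborel) \<le> 2 ^ DIM('a) * (\<integral>\<^sup>+x. g x \<partial>lborel)"
proof -
  let ?d = "DIM('a)"
  have "(\<integral>\<^sup>+x. g x \<partial>lborel)
      = (\<integral>\<^sup>+x. g x \<partial>density (distr lborel borel (\<lambda>x. (x0 - c *\<^sub>R x0) + c *\<^sub>R x)) (\<lambda>_. \<bar>c\<bar>^?d))"
    using lborel_affine[of c "x0 - c *\<^sub>R x0"] c by simp
  also have "\<dots> = (\<integral>\<^sup>+x. ennreal (\<bar>c\<bar>^?d) * g ((x0 - c *\<^sub>R x0) + c *\<^sub>R x) \<partial>lborel)"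
    by (subst nn_integral_density) (auto simp: nn_integral_distr)
  also have "\<dots> = ennreal (c^?d) * (\<integral>\<^sup>+x. g (x0 + c *\<^sub>R (x - x0)) \<partial>lborel)"
    using c by (subst nn_integral_cmult[symmetric]) (auto simp: algebra_simps)
  finally have eq: "(\<integral>\<^sup>+x. g x \<partial>lborel) = ennreal (c^?d) * (\<integral>\<^sup>+x. g (x0 + c *\<^sub>R (x - x0)) \<partial>lborel)" .
  have "1 \<le> ennreal ((2 * c) ^ ?d)"
    using c one_le_power[of "2 * c" ?d] by (simp del: power_mult_distrib)
  then have "1 * (\<integral>\<^sup>+x. g (x0 + c *\<^sub>R (x - x0)) \<partial>lborel)
      \<le> ennreal ((2 * c) ^ ?d) * (\<integral>\<^sup>+x. g (x0 + c *\<^sub>R (x - x0)) \<partial>lborel)"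
    by (rule mult_right_mono) simp
  also have "ennreal ((2 * c) ^ ?d) = 2 ^ ?d * ennreal (c ^ ?d)"
    using c by (simp add: power_mult_distrib ennreal_mult ennreal_power[symmetric])
  finally show ?thesis by (simp add: eq mult.assoc)
qed

text \<open>Averaging the dilates of a thin set \<open>A\<close>: a point \<open>y\<close> is the image of a point of \<open>A\<close> only for parameters
\<open>t\<close> in a set of diameter at most \<open>s\<close>, by \<open>thin\<close>. After exchanging the integrals and substituting
\<open>y = x0 + t (x - x0)\<close> with Jacobian at least \<open>2\<^sup>-\<^sup>d\<close>, this set contributes a factor of order \<open>s\<close>.\<close>

lemma dilation_average:
  fixes f :: "'a::euclidean_space \<Rightarrow> ennreal"
  assumes f [measurable]: "f \<in> borel_measurable borel" and A [measurable]: "A \<in> sets borel"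
    and K [measurable]: "K \<in> sets borel" and s: "0 \<le> s"
    and star: "\<And>x t. x \<in> A \<Longrightarrow> 1/2 \<le> t \<Longrightarrow> t \<le> 1 \<Longrightarrow> x0 + t *\<^sub>R (x - x0) \<in> K"
    and thin: "\<And>y t t'. 1/2 \<le> t \<Longrightarrow> t \<le> t' \<Longrightarrow> t' \<le> 1 \<Longrightarrow>
      x0 + (1/t) *\<^sub>R (y - x0) \<in> A \<Longrightarrow> x0 + (1/t') *\<^sub>R (y - x0) \<in> A \<Longrightarrow> t' - t \<le> s"
  shows "(\<integral>\<^sup>+x. indicator A x * (\<integral>\<^sup>+t. indicator {1/2..1} t * f (x0 + t *\<^sub>R (x - x0)) \<partial>lborel) \<partial>lborel)
    \<le> 2 ^ DIM('a) * ennreal (2 * s) * (\<integral>\<^sup>+y. indicator K y * f y \<partial>lborel)"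
proof -
  define g :: "real \<Rightarrow> 'a \<Rightarrow> ennreal" where "g t y = indicator A (x0 + (1/t) *\<^sub>R (y - x0)) * f y" for t y
  have [measurable]: "(\<lambda>x. g t x) \<in> borel_measurable borel" for t
    unfolding g_def by measurable
  have "(\<integral>\<^sup>+x. indicator A x * (\<integral>\<^sup>+t. indicator {1/2..1} t * f (x0 + t *\<^sub>R (x - x0)) \<partial>lborel) \<partial>lborel)
      = (\<integral>\<^sup>+x. (\<integral>\<^sup>+t. indicator A x * (indicator {1/2..1::real} t * f (x0 + t *\<^sub>R (x - x0))) \<partial>lborel) \<partial>lborel)"
    by (intro nn_integral_cong nn_integral_cmult[symmetric]) measurable
  also have "\<dots> = (\<integral>\<^sup>+t. (\<integral>\<^sup>+x. indicator A x * (indicator {1/2..1::real} t * f (x0 + t *\<^sub>R (x - x0))) \<partial>lborel) \<partial>lborel)"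
    by (rule lborel_pair.Fubini'[symmetric]) measurable
  also have "\<dots> \<le> (\<integral>\<^sup>+t. (\<integral>\<^sup>+y. 2 ^ DIM('a) * (indicator {1/2..1::real} t * g t y) \<partial>lborel) \<partial>lborel)"
  proof (rule nn_integral_mono)
    fix t :: real
    show "(\<integral>\<^sup>+x. indicator A x * (indicator {1/2..1::real} t * f (x0 + t *\<^sub>R (x - x0))) \<partial>lborel)
      \<le> (\<integral>\<^sup>+y. 2 ^ DIM('a) * (indicator {1/2..1::real} t * g t y) \<partial>lborel)"
    proof (cases "t \<in> {1/2..1}")
      case True
      then have t: "1/2 \<le> t" by simp
      have "(\<integral>\<^sup>+x. indicator A x * (indicator {1/2..1::real} t * f (x0 + t *\<^sub>R (x - x0))) \<partial>lborel)
          = (\<integral>\<^sup>+x. g t (x0 + t *\<^sub>R (x - x0)) \<partial>lborel)"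
        using True by (intro nn_integral_cong) (simp add: g_def)
      also have "\<dots> \<le> 2 ^ DIM('a) * (\<integral>\<^sup>+x. g t x \<partial>lborel)"
        by (rule nn_integral_dilation_le[OF _ t]) simp
      finally show ?thesis using True by (simp add: nn_integral_cmult)
    qed simp
  qed
  also have "\<dots> = (\<integral>\<^sup>+y. (\<integral>\<^sup>+t. 2 ^ DIM('a) * (indicator {1/2..1::real} t * g t y) \<partial>lborel) \<partial>lborel)"
    unfolding g_def by (rule lborel_pair.Fubini') measurable
  also have "\<dots> \<le> (\<integral>\<^sup>+y. (2 ^ DIM('a) * ennreal (2 * s)) * (indicator K y * f y) \<partial>lborel)"
  proof (rule nn_integral_mono)
    fix y :: 'a
    define S where "S = {t. 1/2 \<le> t \<and> t \<le> 1 \<and> x0 + (1/t) *\<^sub>R (y - x0) \<in> A}"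
    have [measurable]: "S \<in> sets borel"
      unfolding S_def by measurable
    have "(\<integral>\<^sup>+t. 2 ^ DIM('a) * (indicator {1/2..1::real} t * g t y) \<partial>lborel)
        = (\<integral>\<^sup>+t. (2 ^ DIM('a) * f y) * indicator S t \<partial>lborel)"
      by (intro nn_integral_cong) (auto simp: g_def S_def indicator_def mult_ac)
    also have "\<dots> = (2 ^ DIM('a) * f y) * emeasure lborel S"
      by (simp add: nn_integral_cmult)
    also have "\<dots> \<le> (2 ^ DIM('a) * f y) * (ennreal (2 * s) * indicator K y)"
    proof (rule mult_left_mono)
      show "emeasure lborel S \<le> ennreal (2 * s) * indicator K y"
      proof (cases "S = {}")
        case False
        then obtain t0 where t0: "t0 \<in> S" by auto
        have "S \<subseteq> {t0 - s..t0 + s}"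
        proof
          fix t assume "t \<in> S"
          then show "t \<in> {t0 - s..t0 + s}"
            using t0 thin[of t t0 y] thin[of t0 t y] s unfolding S_def by (cases "t \<le> t0") auto
        qed
        then have "emeasure lborel S \<le> emeasure lborel {t0 - s..t0 + s}"
          by (rule emeasure_mono) auto
        also have "\<dots> = ennreal (2 * s)" using s by simp
        finally have "emeasure lborel S \<le> ennreal (2 * s)" .
        moreover have "y \<in> K"
          using star[of "x0 + (1/t0) *\<^sub>R (y - x0)" t0] t0 by (simp add: S_def)
        ultimately show ?thesis by simp
      qed simp
    qed simp
    finally show "(\<integral>\<^sup>+t. 2 ^ DIM('a) * (indicator {1/2..1::real} t * g t y) \<partial>lborel)
        \<le> (2 ^ DIM('a) * ennreal (2 * s)) * (indicator K y * f y)"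
      by (simp add: mult_ac)
  qed
  also have "\<dots> = 2 ^ DIM('a) * ennreal (2 * s) * (\<integral>\<^sup>+y. indicator K y * f y \<partial>lborel)"
    by (rule nn_integral_cmult) measurable
  finally show ?thesis .
qed

text \<open>Distances are taken to the complement of the interior and not to the frontier, so that any point outside \<open>K\<close>
can serve as a witness for membership in the layer.\<close>

definition boundary_layer :: "real \<Rightarrow> 'a::euclidean_space set \<Rightarrow> 'a set" where
  "boundary_layer \<rho> K = {x \<in> K. infdist x (- interior K) \<le> \<rho>}"

lemma boundary_layer_closed:
  assumes "closed K"
  shows "closed (boundary_layer \<rho> K)"
proof -
  have "closed {x. infdist x (- interior K) \<le> \<rho>}"
    by (intro closed_Collect_le continuous_intros)
  moreover have "boundary_layer \<rho> K = K \<inter> {x. infdist x (- interior K) \<le> \<rho>}"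
    by (auto simp: boundary_layer_def)
  ultimately show ?thesis
    using closed_Int[OF assms] by simp
qed

text \<open>A convex set contains the ball of radius \<open>(1 - l) r\<close> about the point obtained by moving \<open>x\<close> towards the
centre \<open>x0\<close> by the ratio \<open>l\<close>, so such a point is at least that far from the boundary.\<close>

lemma boundary_layer_contracts:
  fixes K :: "'a::euclidean_space set"
  assumes c: "convex K" and b: "bounded K" and r: "cball x0 r \<subseteq> K" "0 \<le> r" and x: "x \<in> K"
    and l: "0 \<le> l" "l \<le> 1" and y: "x0 + l *\<^sub>R (x - x0) \<in> boundary_layer \<rho> K"
  shows "(1 - l) * r \<le> \<rho>"
proof (cases "l = 1 \<or> r = 0")
  case False
  then have l1: "l < 1" and r0: "r > 0" using l r by auto
  let ?y = "x0 + l *\<^sub>R (x - x0)"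
  have "ball ?y ((1 - l) * r) \<subseteq> K"
  proof
    fix p assume p: "p \<in> ball ?y ((1 - l) * r)"
    \<comment> \<open>The point \<open>p\<close> is a convex combination of \<open>x\<close> and a point of the ball about \<open>x0\<close>.\<close>
    define q where "q = x0 + (1 / (1 - l)) *\<^sub>R (p - ?y)"
    have "dist q x0 = (1 / (1 - l)) * dist p ?y"
      using l1 by (simp add: q_def dist_norm)
    also have "\<dots> \<le> r"
      using p l1 by (simp add: dist_commute pos_divide_le_eq mult.commute)
    finally have "q \<in> K" using r by (auto simp: dist_commute)
    moreover have "p = (1 - l) *\<^sub>R q + l *\<^sub>R x"
    proof -
      have "(1 - l) *\<^sub>R q = (1 - l) *\<^sub>R x0 + (p - ?y)"
        using l1 by (simp add: q_def scaleR_add_right)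
      then show ?thesis by (simp add: algebra_simps)
    qed
    ultimately show "p \<in> K"
      using convexD[OF c _ x, of q "1 - l" l] l by simp
  qed
  then have ball: "ball ?y ((1 - l) * r) \<subseteq> interior K"
    by (simp add: interior_maximal)
  have ne: "- interior K \<noteq> {}"
    using b bounded_interior[OF b] not_bounded_UNIV by (metis Compl_UNIV_eq double_compl)
  have "(1 - l) * r \<le> infdist ?y (- interior K)"
    unfolding infdist_notempty[OF ne]
  proof (rule cINF_greatest[OF ne])
    fix p assume "p \<in> - interior K"
    then have "p \<notin> ball ?y ((1 - l) * r)" using ball by auto
    then show "(1 - l) * r \<le> dist ?y p" by simp
  qed
  then show ?thesis using y by (simp add: boundary_layer_def)
next
  case True
  then show ?thesis using y infdist_nonneg[of "x0 + l *\<^sub>R (x - x0)" "- interior K"]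
    by (auto simp: boundary_layer_def)
qed

text \<open>For \<open>x\<close> in the layer compare \<open>u(x)\<close> with \<open>u\<close> at the points \<open>x0 + t (x - x0)\<close> and average over
\<open>1/2 \<le> t \<le> 1\<close>. Both the values of \<open>u\<^sup>2\<close> and the gradients picked up on the way are averages over dilates of
the layer, which is thin in the sense of \<open>dilation_average\<close> by \<open>boundary_layer_contracts\<close>.\<close>

lemma boundary_layer_estimate:
  fixes \<Omega> :: "'a::euclidean_space set"
  assumes m: "mesh_of \<Omega> \<T>" and o: "open \<Omega>" and u: "u \<in> fe_space \<T> \<Omega>"
    and K: "convex K" "compact K" and r: "cball x0 r \<subseteq> K" "0 \<le> r"
    and d: "diameter K \<le> d" and s: "0 \<le> s" "\<rho> < s * r"
  shows "(\<integral>\<^sup>+x. indicator (boundary_layer \<rho> K) x * ennreal ((u x)\<^sup>2) \<partial>lborel)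
    \<le> 2 ^ DIM('a) * ennreal (2 * s) *
      (4 * (\<integral>\<^sup>+x. indicator K x * ennreal ((u x)\<^sup>2) \<partial>lborel)
       + ennreal (d\<^sup>2) * (\<integral>\<^sup>+x. indicator K x * ennreal (grad_sq \<T> u x) \<partial>lborel))"
proof -
  let ?A = "boundary_layer \<rho> K"
  have Kc: "closed K" and Kb: "bounded K" using K by (auto intro: compact_imp_closed compact_imp_bounded)
  have x0: "x0 \<in> K" using r by auto
  have [measurable]: "?A \<in> sets borel" "K \<in> sets borel"
    using boundary_layer_closed[OF Kc] Kc by auto
  define U where "U x = ennreal ((u x)\<^sup>2)" for x
  define Q where "Q x = ennreal (grad_sq \<T> u x)" for x
  have [measurable]: "Q \<in> borel_measurable borel"
    unfolding Q_def using grad_sq_measurable[OF m] by measurable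
  have [measurable]: "u \<in> borel_measurable borel"
    using fe_space_continuous[OF u o] by (rule borel_measurable_continuous_onI)
  have [measurable]: "U \<in> borel_measurable borel"
    unfolding U_def by measurable
  define M where "M f x = (\<integral>\<^sup>+t. indicator {1/2..1} t * f (x0 + t *\<^sub>R (x - x0)) \<partial>lborel)"
    for f :: "'a \<Rightarrow> ennreal" and x
  have [measurable]: "M f \<in> borel_measurable borel" if [measurable]: "f \<in> borel_measurable borel" for f
    unfolding M_def by measurable
  have star: "x0 + t *\<^sub>R (x - x0) \<in> K" if "x \<in> ?A" "1/2 \<le> t" "t \<le> 1" for x t
  proof -
    have "(1 - t) *\<^sub>R x0 + t *\<^sub>R x \<in> K"
      using that x0 K(1) by (intro convexD) (auto simp: boundary_layer_def)
    then show ?thesis by (simp add: algebra_simps)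
  qed
  have thin: "t' - t \<le> s"
    if t: "1/2 \<le> t" "t \<le> t'" "t' \<le> 1"
      and y: "x0 + (1/t) *\<^sub>R (y - x0) \<in> ?A" "x0 + (1/t') *\<^sub>R (y - x0) \<in> ?A" for y t t'
  proof (rule ccontr)
    assume n: "\<not> t' - t \<le> s"
    have "t' * 1 \<le> 1 * 1" and t0: "t' > 0" using t by auto
    have "(1 - t / t') * r \<le> \<rho>"
    proof (rule boundary_layer_contracts[OF K(1) Kb r])
      show "x0 + (1/t) *\<^sub>R (y - x0) \<in> K" using y by (simp add: boundary_layer_def)
      show "x0 + (t / t') *\<^sub>R (x0 + (1/t) *\<^sub>R (y - x0) - x0) \<in> ?A"
        using y t by simp
    qed (use t in auto)
    moreover have "s \<le> 1 - t / t'"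
    proof -
      have "s * t' \<le> s" using t s mult_left_mono[of t' 1 s] by simp
      then show ?thesis using n t0 by (simp add: field_simps)
    qed
    ultimately have "s * r \<le> \<rho>" using r mult_right_mono[of s "1 - t / t'" r] by linarith
    then show False using s by simp
  qed
  have avg: "(\<integral>\<^sup>+x. indicator ?A x * M f x \<partial>lborel)
      \<le> 2 ^ DIM('a) * ennreal (2 * s) * (\<integral>\<^sup>+y. indicator K y * f y \<partial>lborel)"
    if [measurable]: "f \<in> borel_measurable borel" for f
    unfolding M_def by (rule dilation_average[OF that _ _ s(1) star thin]) auto
  have pt: "U x \<le> 4 * M U x + ennreal (d\<^sup>2) * M Q x" if x: "x \<in> ?A" for x
  proof -
    have nd: "norm (x - x0) \<le> d"
      using diameter_bounded_bound[OF Kb, of x x0] x x0 d by (auto simp: boundary_layer_def dist_norm)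
    \<comment> \<open>The coefficient \<open>d\<^sup>2\<close> bounds \<open>2 * (1 - t) * d\<^sup>2\<close> for \<open>t \<ge> 1/2\<close>.\<close>
    have t1: "U x \<le> 2 * U (x0 + t *\<^sub>R (x - x0)) + ennreal (d\<^sup>2) * M Q x" if t: "t \<in> {1/2..1}" for t
    proof -
      define w where "w = u (x0 + t *\<^sub>R (x - x0))"
      have "ennreal ((u (x0 + 1 *\<^sub>R (x - x0)) - w)\<^sup>2) \<le> ennreal ((1 - t) * (norm (x - x0))\<^sup>2)
          * (\<integral>\<^sup>+\<tau>. indicator {t..1} \<tau> * ennreal (grad_sq \<T> u (x0 + \<tau> *\<^sub>R (x - x0))) \<partial>lborel)"
        unfolding w_def using t by (intro line_estimate[OF m o u]) auto
      also have "\<dots> \<le> ennreal (1/2 * d\<^sup>2) * M Q x"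
      proof (rule mult_mono)
        show "ennreal ((1 - t) * (norm (x - x0))\<^sup>2) \<le> ennreal (1/2 * d\<^sup>2)"
          using t nd by (intro ennreal_leI mult_mono power_mono) auto
        show "(\<integral>\<^sup>+\<tau>. indicator {t..1} \<tau> * ennreal (grad_sq \<T> u (x0 + \<tau> *\<^sub>R (x - x0))) \<partial>lborel) \<le> M Q x"
          unfolding M_def Q_def using t
          by (intro nn_integral_mono mult_right_mono) (auto simp: indicator_def)
      qed auto
      finally have "ennreal ((u x - w)\<^sup>2) \<le> ennreal (1/2 * d\<^sup>2) * M Q x" by simp
      then have 1: "2 * ennreal ((u x - w)\<^sup>2) \<le> 2 * (ennreal (1/2 * d\<^sup>2) * M Q x)"
        by (rule mult_left_mono) simp
      have "0 \<le> (u x - 2 * w)\<^sup>2" by simp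
      then have "(u x)\<^sup>2 \<le> 2 * w\<^sup>2 + 2 * (u x - w)\<^sup>2" by (simp add: power2_eq_square algebra_simps)
      then have "U x \<le> ennreal (2 * w\<^sup>2 + 2 * (u x - w)\<^sup>2)" unfolding U_def by (rule ennreal_leI)
      also have "\<dots> = 2 * ennreal (w\<^sup>2) + 2 * ennreal ((u x - w)\<^sup>2)"
        by (simp add: ennreal_mult'')
      also have "\<dots> \<le> 2 * ennreal (w\<^sup>2) + 2 * (ennreal (1/2 * d\<^sup>2) * M Q x)"
        using 1 by (rule add_left_mono)
      also have "2 * (ennreal (1/2 * d\<^sup>2) * M Q x) = ennreal (2 * (1/2 * d\<^sup>2)) * M Q x"
        by (subst ennreal_mult'') (auto simp: mult.assoc)
      finally show ?thesis by (simp add: U_def w_def)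
    qed
    have "ennreal (1/2) * U x = (\<integral>\<^sup>+t. indicator {1/2..1::real} t * U x \<partial>lborel)"
      by (subst nn_integral_multc) (auto simp: emeasure_lborel_Icc_eq)
    also have "\<dots> \<le> (\<integral>\<^sup>+t. 2 * (indicator {1/2..1::real} t * U (x0 + t *\<^sub>R (x - x0)))
          + indicator {1/2..1::real} t * (ennreal (d\<^sup>2) * M Q x) \<partial>lborel)"
    proof (rule nn_integral_mono)
      fix t :: real
      show "indicator {1/2..1::real} t * U x \<le> 2 * (indicator {1/2..1::real} t * U (x0 + t *\<^sub>R (x - x0)))
          + indicator {1/2..1::real} t * (ennreal (d\<^sup>2) * M Q x)"
        using t1[of t] by (cases "t \<in> {1/2..1}") auto
    qed
    also have "\<dots> = 2 * M U x + ennreal (1/2) * (ennreal (d\<^sup>2) * M Q x)"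
      unfolding M_def[of U]
      by (subst nn_integral_add) (auto simp: nn_integral_cmult nn_integral_multc mult.commute)
    finally have "2 * (ennreal (1/2) * U x) \<le> 2 * (2 * M U x + ennreal (1/2) * (ennreal (d\<^sup>2) * M Q x))"
      by (rule mult_left_mono) simp
    moreover have h: "2 * (ennreal (1/2) * y) = y" for y
    proof -
      have "2 * ennreal (1/2) = 1"
        by (metis ennreal_1 ennreal_mult'' ennreal_numeral mult_2 field_sum_of_halves zero_le_divide_1_iff zero_le_numeral)
      then show ?thesis by (simp add: mult.assoc[symmetric])
    qed
    ultimately show ?thesis by (simp add: distrib_left h mult.assoc[symmetric])
  qed
  have "(\<integral>\<^sup>+x. indicator ?A x * U x \<partial>lborel)
      \<le> (\<integral>\<^sup>+x. 4 * (indicator ?A x * M U x) + ennreal (d\<^sup>2) * (indicator ?A x * M Q x) \<partial>lborel)"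
    using pt by (intro nn_integral_mono) (auto simp: indicator_def)
  also have "\<dots> = 4 * (\<integral>\<^sup>+x. indicator ?A x * M U x \<partial>lborel)
      + ennreal (d\<^sup>2) * (\<integral>\<^sup>+x. indicator ?A x * M Q x \<partial>lborel)"
    by (subst nn_integral_add) (auto simp: nn_integral_cmult)
  also have "\<dots> \<le> 4 * (2 ^ DIM('a) * ennreal (2 * s) * (\<integral>\<^sup>+y. indicator K y * U y \<partial>lborel))
      + ennreal (d\<^sup>2) * (2 ^ DIM('a) * ennreal (2 * s) * (\<integral>\<^sup>+y. indicator K y * Q y \<partial>lborel))"
    by (intro add_mono mult_left_mono avg) auto
  finally show ?thesis
    by (simp add: U_def Q_def distrib_left mult_ac)
qed

section \<open>Gradients of interpolated products\<close>

lemma pw_linear_osc_on_hull: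
  assumes m: "mesh_of \<Omega> \<T>" and w: "pw_linear \<T> \<Omega> w" and T: "T \<in> \<T>"
    and osc: "\<And>y. y extreme_point_of T \<Longrightarrow> \<bar>w y - z\<bar> \<le> M" and x: "x \<in> T"
  shows "\<bar>w x - z\<bar> \<le> M"
proof -
  obtain b where b: "\<And>x. x \<in> T \<Longrightarrow> w x = egrad T w \<bullet> x + b"
    using pw_linear_egrad[OF m w T] by blast
  have hull: "x \<in> convex hull {x. x extreme_point_of T}"
    using mesh_element_hull[OF m T] x by blast
  have e: "\<bar>egrad T w \<bullet> y + b - z\<bar> \<le> M" if "y \<in> {x. x extreme_point_of T}" for y
    using osc[of y] b[of y] that by (simp add: extreme_point_of_def)
  have "0 \<le> egrad T w \<bullet> x + (b - z + M)"
    by (rule affine_ge_on_hull[OF _ hull]) (use e in fastforce)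
  moreover have "0 \<le> (- egrad T w) \<bullet> x + (z - b + M)"
    by (rule affine_ge_on_hull[OF _ hull]) (use e in fastforce)
  ultimately show ?thesis using b[OF x] by simp
qed

text \<open>An affine function varies by \<open>2 r |\<nabla>w|\<close> across a ball of radius \<open>r\<close>, and its oscillation on an element is
attained at the vertices.\<close>

lemma egrad_le_oscillation:
  assumes m: "mesh_of \<Omega> \<T>" and w: "pw_linear \<T> \<Omega> w" and T: "T \<in> \<T>"
    and r: "cball c r \<subseteq> T" "0 < r"
    and osc: "\<And>y. y extreme_point_of T \<Longrightarrow> \<bar>w y - z\<bar> \<le> M"
  shows "norm (egrad T w) \<le> M / r"
proof (cases "egrad T w = 0")
  case False
  let ?g = "egrad T w"
  define y where "y s = c + (s * r / norm ?g) *\<^sub>R ?g" for s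
  have yT: "y s \<in> T" if "\<bar>s\<bar> = 1" for s
    using r that False by (intro subsetD[OF r(1)]) (simp add: y_def dist_norm abs_mult)
  have "w (y 1) - w (y (- 1)) = ?g \<bullet> (y 1 - y (- 1))"
    by (rule pw_linear_diff[OF m w T]) (simp_all add: yT)
  also have "y 1 - y (- 1) = (2 * r / norm ?g) *\<^sub>R ?g"
    by (simp add: y_def flip: scaleR_add_left)
  also have "?g \<bullet> ((2 * r / norm ?g) *\<^sub>R ?g) = 2 * r * norm ?g"
    using False by (simp add: dot_square_norm power2_eq_square)
  finally have "2 * r * norm ?g = (w (y 1) - z) - (w (y (- 1)) - z)" by simp
  also have "\<dots> \<le> 2 * M"
    using pw_linear_osc_on_hull[OF m w T osc, of "y 1"] pw_linear_osc_on_hull[OF m w T osc, of "y (- 1)"] yT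
    by fastforce
  finally show ?thesis using r by (simp add: pos_le_divide_eq mult.commute)
next
  case True
  obtain y where "y extreme_point_of T"
    using mesh_element_hull[OF m T] mesh_element(4)[OF m T] by fastforce
  then have "0 \<le> M" using osc by fastforce
  then show ?thesis using True r by simp
qed

text \<open>A product rule for interpolated products. The difference of \<open>\<theta> e\<close> between two vertices \<open>y\<close> and \<open>y0\<close> is
\<open>\<theta>(y) (e(y) - e(y0)) + e(y0) (\<theta>(y) - \<theta>(y0))\<close>, where \<open>e(y0)\<close> is traded for \<open>e(x)\<close>. In the error term of this
trade the oscillation of \<open>\<theta>\<close> is bounded by 1 and not by its gradient, which keeps the estimate independent of the
ratio of \<open>h\<close> and \<open>\<delta>\<close>. The point \<open>x\<close> is arbitrary so that the bound can be integrated over the element.\<close>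

lemma nodal_product_gradient:
  fixes \<Omega> :: "'a::euclidean_space set"
  assumes m: "mesh_of \<Omega> \<T>" and th: "pw_linear \<T> \<Omega> \<theta>" and e: "pw_linear \<T> \<Omega> e" and T: "T \<in> \<T>"
    and r: "cball c r \<subseteq> T" "0 < r" and d: "diameter T \<le> d"
    and th01: "\<And>y. y \<in> T \<Longrightarrow> 0 \<le> \<theta> y \<and> \<theta> y \<le> 1" and x: "x \<in> T"
  shows "(norm (egrad T (nodal_interp \<T> \<Omega> (\<lambda>y. \<theta> y * e y))))\<^sup>2
    \<le> (d / r)\<^sup>2 * (8 * (norm (egrad T e))\<^sup>2 + 2 * (norm (egrad T \<theta>))\<^sup>2 * (e x)\<^sup>2)"
proof -
  let ?w = "nodal_interp \<T> \<Omega> (\<lambda>y. \<theta> y * e y)"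
  define ge where "ge = norm (egrad T e)"
  define gt where "gt = norm (egrad T \<theta>)"
  have Lip: "\<bar>f y - f y'\<bar> \<le> norm (egrad T f) * d"
    if f: "pw_linear \<T> \<Omega> f" and y: "y \<in> T" "y' \<in> T" for f y y'
  proof -
    have "\<bar>f y - f y'\<bar> \<le> norm (egrad T f) * norm (y - y')"
      using pw_linear_diff[OF m f T y] Cauchy_Schwarz_ineq2[of "egrad T f" "y - y'"] by simp
    also have "norm (y - y') \<le> d"
      using diameter_bounded_bound[OF mesh_element(7)[OF m T] y] d by (simp add: dist_norm)
    finally show ?thesis by (simp add: mult_left_mono)
  qed
  have wv: "?w y = \<theta> y * e y" if "y extreme_point_of T" for y
    using nodal_interp(2)[OF m extreme_point_mesh_vertex[OF T that]] .
  obtain y0 where y0: "y0 extreme_point_of T"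
    using mesh_element_hull[OF m T] mesh_element(4)[OF m T] by fastforce
  have y0T: "y0 \<in> T" using y0 by (simp add: extreme_point_of_def)
  have "norm (egrad T ?w) \<le> (d * (2 * ge + gt * \<bar>e x\<bar>)) / r"
  proof (rule egrad_le_oscillation[OF m nodal_interp(1)[OF m] T r])
    fix y assume y: "y extreme_point_of T"
    then have yT: "y \<in> T" by (simp add: extreme_point_of_def)
    have "\<bar>?w y - ?w y0\<bar> = \<bar>\<theta> y * (e y - e y0) + (e y0 - e x) * (\<theta> y - \<theta> y0) + e x * (\<theta> y - \<theta> y0)\<bar>"
      using wv[OF y] wv[OF y0] by (simp add: algebra_simps)
    also have "\<dots> \<le> \<bar>\<theta> y\<bar> * \<bar>e y - e y0\<bar> + \<bar>e y0 - e x\<bar> * \<bar>\<theta> y - \<theta> y0\<bar> + \<bar>e x\<bar> * \<bar>\<theta> y - \<theta> y0\<bar>"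
      unfolding abs_mult[symmetric] by linarith
    also have "\<dots> \<le> 1 * (ge * d) + (ge * d) * 1 + \<bar>e x\<bar> * (gt * d)"
      using th01[OF yT] th01[OF y0T] Lip[OF e yT y0T] Lip[OF e y0T x] Lip[OF th yT y0T]
      unfolding ge_def gt_def
      by (intro add_mono mult_mono) auto
    finally show "\<bar>?w y - ?w y0\<bar> \<le> d * (2 * ge + gt * \<bar>e x\<bar>)"
      by (simp add: algebra_simps)
  qed
  then have "norm (egrad T ?w) \<le> (d / r) * (2 * ge + gt * \<bar>e x\<bar>)" by simp
  then have "(norm (egrad T ?w))\<^sup>2 \<le> ((d / r) * (2 * ge + gt * \<bar>e x\<bar>))\<^sup>2"
    by (rule power_mono) simp
  also have "\<dots> = (d / r)\<^sup>2 * (2 * ge + gt * \<bar>e x\<bar>)\<^sup>2" by (rule power_mult_distrib)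
  also have "(2 * ge + gt * \<bar>e x\<bar>)\<^sup>2 \<le> 8 * ge\<^sup>2 + 2 * gt\<^sup>2 * (e x)\<^sup>2"
  proof -
    have "0 \<le> (2 * ge - gt * \<bar>e x\<bar>)\<^sup>2" by simp
    then have "(2 * ge + gt * \<bar>e x\<bar>)\<^sup>2 \<le> 2 * (2 * ge)\<^sup>2 + 2 * (gt * \<bar>e x\<bar>)\<^sup>2"
      by (simp add: power2_eq_square algebra_simps)
    then show ?thesis by (simp add: power_mult_distrib)
  qed
  finally show ?thesis by (simp add: ge_def gt_def mult_left_mono)
qed

lemma egrad_eqI_interior:
  assumes m: "mesh_of \<Omega> \<T>" and u: "pw_linear \<T> \<Omega> u" and T: "T \<in> \<T>"
    and c: "\<And>x. x \<in> interior T \<Longrightarrow> u x = c"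
  shows "egrad T u = 0"
proof -
  obtain b where b: "\<And>x. x \<in> T \<Longrightarrow> u x = egrad T u \<bullet> x + b"
    using pw_linear_egrad[OF m u T] by blast
  have "\<forall>x\<in>interior T. egrad T u \<bullet> x + b = 0 \<bullet> x + c"
    using b c interior_subset by fastforce
  then show ?thesis
    by (rule affine_gradient_unique[rotated]) (simp add: mesh_element(4)[OF m T])
qed

text \<open>The gradient is constant on the interior of \<open>T\<close>, which has positive measure.\<close>

lemma egrad_le_of_AE:
  assumes m: "mesh_of \<Omega> \<T>" and u: "pw_linear \<T> \<Omega> u" and T: "T \<in> \<T>"
    and D: "interior T \<subseteq> D" and AE: "AE x in lebesgue. x \<in> D \<longrightarrow> norm (grad u x) \<le> L"
  shows "norm (egrad T u) \<le> L"
proof (rule ccontr)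
  assume n: "\<not> ?thesis"
  have "AE x in lebesgue. x \<notin> interior T"
    using AE by (rule AE_mp) (use D n grad_eq_egrad[OF m u T] in auto)
  then have "interior T \<in> null_sets lebesgue"
    by (subst AE_iff_null_sets) auto
  then have "negligible (interior T)" by (simp add: negligible_iff_null_sets)
  then show False
    using mesh_element(4)[OF m T] open_not_negligible[of "interior T"] by simp
qed

section \<open>Localization of the partition of unity\<close>

text \<open>Subdomains sharing an element have different colours.\<close>

lemma card_subdomains_le_colors:
  assumes c: "colorable_with Nc N D'" and T: "interior T \<noteq> {}"
  shows "card {k \<in> {1..N}. interior T \<subseteq> D' k} \<le> Nc"
proof -
  obtain c :: "nat \<Rightarrow> nat" where c: "\<And>k. k\<in>{1..N} \<Longrightarrow> c k < Nc"
    "\<And>i j. i\<in>{1..N} \<Longrightarrow> j\<in>{1..N} \<Longrightarrow> i \<noteq> j \<Longrightarrow> c i = c j \<Longrightarrow> D' i \<inter> D' j = {}"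
    using c unfolding colorable_with_def by blast
  have "card {k \<in> {1..N}. interior T \<subseteq> D' k} \<le> card {..<Nc}"
  proof (rule card_inj_on_le)
    show "inj_on c {k \<in> {1..N}. interior T \<subseteq> D' k}"
    proof (rule inj_onI, rule ccontr)
      fix i j assume ij: "i \<in> {k \<in> {1..N}. interior T \<subseteq> D' k}" "j \<in> {k \<in> {1..N}. interior T \<subseteq> D' k}"
        "c i = c j" "i \<noteq> j"
      then have "D' i \<inter> D' j = {}" by (intro c(2)) auto
      then show False using ij T by blast
    qed
  qed (use c(1) in auto)
  then show ?thesis by simp
qed

text \<open>If \<open>\<theta> k\<close> is not constant on \<open>T\<close>, then another \<open>\<theta> j\<close> is nonzero on \<open>T\<close>, and \<open>T\<close> belongs to both \<open>D' k\<close> and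
\<open>D' j\<close>. The coarse element \<open>K\<close> containing \<open>T\<close> can be part of only one of the disjoint sets \<open>D k\<close> and \<open>D j\<close>;
the other one lies outside the interior of \<open>K\<close> and is within \<open>\<kappa>\<delta>\<close> of \<open>x\<close>.\<close>

lemma gradient_in_boundary_layer:
  fixes \<Omega> :: "'a::euclidean_space set"
  assumes r: "interior (closure \<Omega>) = \<Omega>"
    and mh: "mesh_of \<Omega> \<T>h" and mH: "mesh_of \<Omega> \<T>H" and ref: "mesh_refinement \<T>h \<T>H"
    and nd: "nonoverlapping_decomposition \<Omega> \<T>H M N D"
    and en: "enlarged_by_layers \<Omega> \<T>h \<kappa> N D \<delta> D'"
    and pu: "pl_partition_of_unity \<Omega> \<T>h \<kappa> N \<delta> D' \<theta>"
    and k: "k \<in> {1..N}" and T: "T \<in> \<T>h" "interior T \<subseteq> D' k" and x: "x \<in> interior T"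
    and g: "egrad T (\<theta> k) \<noteq> 0"
  shows "\<exists>K\<in>\<T>H. x \<in> boundary_layer (\<kappa> * \<delta>) K"
proof -
  have pw: "pw_linear \<T>h \<Omega> (\<theta> i)" if "i \<in> {1..N}" for i
    using pu that by (simp add: pl_partition_of_unity_def)
  \<comment> \<open>A second subdomain is active on the element, as the functions \<open>\<theta> i\<close> add up to 1.\<close>
  obtain y where y: "y \<in> interior T" "\<theta> k y \<noteq> 1"
    using egrad_eqI_interior[OF mh pw[OF k] T(1), of 1] g by blast
  have y\<Omega>: "y \<in> \<Omega>" "y \<in> closure \<Omega>"
    using y(1) interior_mono[OF mesh_element(5)[OF mh T(1)]] r closure_subset by auto
  have "(\<Sum>i=1..N. \<theta> i y) = 1"
    using pu y\<Omega> by (simp add: pl_partition_of_unity_def)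
  then have "\<theta> k y + (\<Sum>i\<in>{1..N}-{k}. \<theta> i y) = 1"
    using sum.remove[of "{1..N}" k "\<lambda>i. \<theta> i y"] k by simp
  then have "(\<Sum>i\<in>{1..N}-{k}. \<theta> i y) \<noteq> 0" using y by simp
  then obtain j where j: "j \<in> {1..N}" "j \<noteq> k" "\<theta> j y \<noteq> 0"
    using sum.neutral[of "{1..N}-{k}" "\<lambda>i. \<theta> i y"] by blast
  then have yj: "y \<in> D' j"
    using pu y\<Omega> unfolding pl_partition_of_unity_def by blast
  obtain \<E> where E: "\<E> \<subseteq> \<T>h" "D' j = interior (\<Union>\<E>)"
    using en j unfolding enlarged_by_layers_def union_of_elements_def by blast
  have "T \<in> \<E>"
    using mesh_interior_cases[OF mh E(1) T(1)] y(1) yj E(2) interior_subset[of "\<Union>\<E>"]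
    by (auto split: if_splits)
  then have "interior T \<subseteq> D' j"
    using mesh_interior_cases[OF mh E(1) T(1)] E(2) by simp
  then have xD: "x \<in> D' k" "x \<in> D' j" using x T(2) by auto
  obtain K where K: "K \<in> \<T>H" "T \<subseteq> K"
    using ref T(1) by (auto simp: mesh_refinement_def)
  have xK: "x \<in> K" using x K interior_subset by blast
  have cases: "D i \<noteq> {} \<and> (interior K \<subseteq> D i \<or> interior K \<inter> D i = {})" if i: "i \<in> {1..N}" for i
  proof -
    obtain \<F> where F: "\<F> \<subseteq> \<T>H" "\<F> \<noteq> {}" "D i = interior (\<Union>\<F>)"
      using nd i unfolding nonoverlapping_decomposition_def by blast
    then obtain K' where K': "K' \<in> \<F>" by blast
    then have "interior K' \<subseteq> D i" using F by (simp add: Sup_upper interior_mono)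
    moreover have "interior K' \<noteq> {}" using mesh_element(4)[OF mH] K' F by blast
    ultimately have "D i \<noteq> {}" by auto
    moreover have "interior K \<subseteq> D i \<or> interior K \<inter> D i = {}"
      using mesh_interior_cases[OF mH F(1) K(1)] F(3) interior_subset[of "\<Union>\<F>"]
      by (cases "K \<in> \<F>") auto
    ultimately show ?thesis by blast
  qed
  have "D k \<inter> D j = {}"
    using nd k j unfolding nonoverlapping_decomposition_def by blast
  then have "\<not> (interior K \<subseteq> D k \<and> interior K \<subseteq> D j)"
    using mesh_element(4)[OF mH K(1)] by blast
  then obtain i where i: "i \<in> {1..N}" "x \<in> D' i" "interior K \<inter> D i = {}" "D i \<noteq> {}"
    using cases[OF k] cases[OF j(1)] k j(1) xD by blast
  then have "D i \<subseteq> - interior K" by blast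
  then have "infdist x (- interior K) \<le> infdist x (D i)"
    using i(4) by (rule infdist_mono)
  also have "\<dots> \<le> \<kappa> * \<delta>"
    using en i unfolding enlarged_by_layers_def by blast
  finally show ?thesis
    using xK K(1) by (auto simp: boundary_layer_def)
qed

section \<open>Energy of the decomposition\<close>

lemma nn_integral_grad_sq:
  assumes m: "mesh_of \<Omega> \<T>"
  shows "(\<integral>\<^sup>+x. ennreal (grad_sq \<T> u x) \<partial>lborel) = ennreal (energy \<T> u)"
proof -
  have fin: "emeasure lborel T = ennreal (measure lebesgue T)" if T: "T \<in> \<T>" for T
  proof -
    have "T \<in> sets borel" using mesh_element(3)[OF m T] by simp
    moreover have "emeasure lborel T < \<infinity>" using emeasure_bounded_finite[OF mesh_element(7)[OF m T]] .
    ultimately show ?thesis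
      by (simp add: emeasure_eq_ennreal_measure measure_completion)
  qed
  have [measurable]: "T \<in> sets borel" if "T \<in> \<T>" for T
    using mesh_element(3)[OF m that] by simp
  have "(\<integral>\<^sup>+x. ennreal (grad_sq \<T> u x) \<partial>lborel)
      = (\<integral>\<^sup>+x. (\<Sum>T\<in>\<T>. indicator T x * ennreal ((norm (egrad T u))\<^sup>2)) \<partial>lborel)"
  proof (rule nn_integral_cong)
    fix x
    have "ennreal (grad_sq \<T> u x) = (\<Sum>T\<in>\<T>. ennreal (indicator T x * (norm (egrad T u))\<^sup>2))"
      unfolding grad_sq_def by (rule sum_ennreal[symmetric]) auto
    also have "\<dots> = (\<Sum>T\<in>\<T>. indicator T x * ennreal ((norm (egrad T u))\<^sup>2))"
      by (rule sum.cong) (auto simp: indicator_def)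
    finally show "ennreal (grad_sq \<T> u x) = (\<Sum>T\<in>\<T>. indicator T x * ennreal ((norm (egrad T u))\<^sup>2))" .
  qed
  also have "\<dots> = (\<Sum>T\<in>\<T>. (\<integral>\<^sup>+x. indicator T x * ennreal ((norm (egrad T u))\<^sup>2) \<partial>lborel))"
    by (rule nn_integral_sum) measurable
  also have "\<dots> = (\<Sum>T\<in>\<T>. ennreal (measure lebesgue T * (norm (egrad T u))\<^sup>2))"
    by (rule sum.cong) (auto simp: nn_integral_multc fin ennreal_mult')
  also have "\<dots> = ennreal (energy \<T> u)"
    unfolding energy_def by (rule sum_ennreal) auto
  finally show ?thesis .
qed

text \<open>Elements overlap only in null sets.\<close>

lemma sum_nn_integral_elements_le:
  fixes f :: "'a::euclidean_space \<Rightarrow> ennreal"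
  assumes m: "mesh_of \<Omega> \<T>" and [measurable]: "f \<in> borel_measurable borel"
  shows "(\<Sum>K\<in>\<T>. (\<integral>\<^sup>+x. indicator K x * f x \<partial>lborel)) \<le> (\<integral>\<^sup>+x. f x \<partial>lborel)"
proof -
  have [measurable]: "T \<in> sets borel" if "T \<in> \<T>" for T
    using mesh_element(3)[OF m that] by simp
  have "(\<Sum>K\<in>\<T>. (\<integral>\<^sup>+x. indicator K x * f x \<partial>lborel)) = (\<integral>\<^sup>+x. (\<Sum>K\<in>\<T>. indicator K x * f x) \<partial>lborel)"
    by (rule nn_integral_sum[symmetric]) measurable
  also have "\<dots> \<le> (\<integral>\<^sup>+x. f x \<partial>lborel)"
  proof (rule nn_integral_mono_AE)
    have "AE x in lborel. \<forall>T\<in>\<T>. x \<in> T \<longrightarrow> x \<in> interior T"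
      using AE_mesh_interior[OF m] by (simp add: AE_completion_iff)
    then show "AE x in lborel. (\<Sum>K\<in>\<T>. indicator K x * f x) \<le> f x"
    proof (rule AE_mp, intro AE_I2 impI)
      fix x assume x: "\<forall>T\<in>\<T>. x \<in> T \<longrightarrow> x \<in> interior T"
      show "(\<Sum>K\<in>\<T>. indicator K x * f x) \<le> f x"
      proof (cases "\<exists>T\<in>\<T>. x \<in> T")
        case True
        then obtain T where T: "T \<in> \<T>" "x \<in> T" by auto
        have "(\<Sum>K\<in>\<T>. indicator K x * f x) = (\<Sum>K\<in>\<T>. if K = T then f x else 0)"
        proof (rule sum.cong[OF refl])
          fix S assume S: "S \<in> \<T>"
          show "indicator S x * f x = (if S = T then f x else 0)"
            using mesh_interior_disjoint[OF m T(1) S] x T S by (auto simp: indicator_def)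
        qed
        then show ?thesis using T mesh_finite[OF m] by simp
      next
        case False
        then show ?thesis by (simp add: indicator_def sum.neutral)
      qed
    qed
  qed
  finally show ?thesis .
qed

text \<open>The pointwise combination of the product rule, the gradient bound for \<open>\<theta> k\<close>, its localization, and the
colouring. The sum of indicators counts the coarse layers at \<open>x\<close>; it only matters that it is at least 1 wherever
some \<open>\<theta> k\<close> has a nonzero gradient.\<close>

lemma sum_grad_sq_le:
  fixes \<Omega> :: "'a::euclidean_space set"
  assumes r: "interior (closure \<Omega>) = \<Omega>" and \<kappa>: "\<kappa> \<ge> 1"
    and mh: "mesh_of \<Omega> \<T>h" and qh: "quasi_uniform \<kappa> h \<T>h"
    and mH: "mesh_of \<Omega> \<T>H" and ref: "mesh_refinement \<T>h \<T>H"
    and nd: "nonoverlapping_decomposition \<Omega> \<T>H M N D"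
    and en: "enlarged_by_layers \<Omega> \<T>h \<kappa> N D \<delta> D'"
    and col: "colorable_with Nc N D'"
    and pu: "pl_partition_of_unity \<Omega> \<T>h \<kappa> N \<delta> D' \<theta>"
    and e: "e \<in> fe_space \<T>h \<Omega>"
    and w: "\<And>k. w k = nodal_interp \<T>h \<Omega> (\<lambda>y. \<theta> k y * e y)"
    and w0: "\<And>k y. k \<in> {1..N} \<Longrightarrow> y \<notin> D' k \<Longrightarrow> w k y = 0"
    and x: "\<forall>T\<in>\<T>h. x \<in> T \<longrightarrow> x \<in> interior T"
  shows "(\<Sum>k=1..N. grad_sq \<T>h (w k) x) \<le> real Nc * \<kappa>^4 *
    (8 * grad_sq \<T>h e x
      + 2 * (\<kappa> / \<delta>)\<^sup>2 * (\<Sum>K\<in>\<T>H. indicator (boundary_layer (\<kappa> * \<delta>) K) x * (e x)\<^sup>2))"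
    (is "_ \<le> _ * ?B")
proof (cases "\<exists>T\<in>\<T>h. x \<in> T")
  case False
  have "grad_sq \<T>h (w k) x = 0" for k
    unfolding grad_sq_def using False by (intro sum.neutral) auto
  moreover have "0 \<le> ?B"
    by (intro add_nonneg_nonneg mult_nonneg_nonneg sum_nonneg grad_sq_nonneg) auto
  ultimately show ?thesis using \<kappa> by simp
next
  case True
  then obtain T where T: "T \<in> \<T>h" "x \<in> T" by auto
  define S :: real where "S = (\<Sum>K\<in>\<T>H. indicator (boundary_layer (\<kappa> * \<delta>) K) x)"
  have S0: "0 \<le> S" unfolding S_def by (intro sum_nonneg) auto
  have gs: "grad_sq \<T>h u x = (norm (egrad T u))\<^sup>2" for u
    unfolding grad_sq_def by (rule sum_indicator_mesh[OF mh x T])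
  have B: "?B = 8 * (norm (egrad T e))\<^sup>2 + 2 * (\<kappa> / \<delta>)\<^sup>2 * (S * (e x)\<^sup>2)"
    by (simp add: gs S_def sum_distrib_right)
  have pe: "pw_linear \<T>h \<Omega> e" using e by (simp add: fe_space_def)
  have pth: "pw_linear \<T>h \<Omega> (\<theta> k)" if "k \<in> {1..N}" for k
    using pu that by (simp add: pl_partition_of_unity_def)
  have h: "h > 0" "diameter T \<le> \<kappa> * h" using qh T by (auto simp: quasi_uniform_def)
  obtain c where c: "cball c (h / \<kappa>) \<subseteq> T" using qh T by (auto simp: quasi_uniform_def)
  have \<delta>: "\<delta> > 0" using en by (simp add: enlarged_by_layers_def)
  have one: "(norm (egrad T (w k)))\<^sup>2 \<le> (if interior T \<subseteq> D' k then \<kappa>^4 * ?B else 0)"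
    if k: "k \<in> {1..N}" for k
  proof (cases "interior T \<subseteq> D' k")
    case True
    have "(norm (egrad T (w k)))\<^sup>2 \<le> (\<kappa> * h / (h / \<kappa>))\<^sup>2 *
        (8 * (norm (egrad T e))\<^sup>2 + 2 * (norm (egrad T (\<theta> k)))\<^sup>2 * (e x)\<^sup>2)"
      unfolding w
    proof (rule nodal_product_gradient[OF mh pth[OF k] pe T(1) c _ h(2) _ T(2)])
      show "0 < h / \<kappa>" using h \<kappa> by simp
      show "0 \<le> \<theta> k y \<and> \<theta> k y \<le> 1" if "y \<in> T" for y
        using pu k that mesh_element(5)[OF mh T(1)] unfolding pl_partition_of_unity_def by blast
    qed
    also have "(\<kappa> * h / (h / \<kappa>))\<^sup>2 = \<kappa>^4"
      using h \<kappa> by (simp add: power2_eq_square power4_eq_xxxx)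
    also have "\<kappa>^4 * (8 * (norm (egrad T e))\<^sup>2 + 2 * (norm (egrad T (\<theta> k)))\<^sup>2 * (e x)\<^sup>2) \<le> \<kappa>^4 * ?B"
    proof -
      have "(norm (egrad T (\<theta> k)))\<^sup>2 \<le> (\<kappa> / \<delta>)\<^sup>2 * S"
      proof (cases "egrad T (\<theta> k) = 0")
        case False
        obtain K where K: "K \<in> \<T>H" "x \<in> boundary_layer (\<kappa> * \<delta>) K"
          using gradient_in_boundary_layer[OF r mh mH ref nd en pu k T(1) True _ False] x T by blast
        have "indicator (boundary_layer (\<kappa> * \<delta>) K) x \<le> S"
          unfolding S_def using K mesh_finite[OF mH] by (intro member_le_sum) auto
        then have S1: "1 \<le> S" using K by simp
        have "AE x in lebesgue. x \<in> D' k \<longrightarrow> norm (grad (\<theta> k) x) \<le> \<kappa> / \<delta>"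
          using pu k by (simp add: pl_partition_of_unity_def)
        then have "norm (egrad T (\<theta> k)) \<le> \<kappa> / \<delta>"
          by (rule egrad_le_of_AE[OF mh pth[OF k] T(1) True])
        then have "(norm (egrad T (\<theta> k)))\<^sup>2 \<le> (\<kappa> / \<delta>)\<^sup>2 * 1" by (simp add: power_mono)
        also have "\<dots> \<le> (\<kappa> / \<delta>)\<^sup>2 * S" using S1 by (intro mult_left_mono) auto
        finally show ?thesis .
      qed (simp add: S0)
      then have "(norm (egrad T (\<theta> k)))\<^sup>2 * (e x)\<^sup>2 \<le> (\<kappa> / \<delta>)\<^sup>2 * S * (e x)\<^sup>2"
        by (rule mult_right_mono) simp
      then show ?thesis
        unfolding B using \<kappa> by (intro mult_left_mono) (auto simp: mult.assoc)
    qed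
    finally show ?thesis using True by simp
  next
    case False
    obtain \<E> where E: "\<E> \<subseteq> \<T>h" "D' k = interior (\<Union>\<E>)"
      using en k unfolding enlarged_by_layers_def union_of_elements_def by blast
    then have "interior T \<inter> D' k = {}"
      using mesh_interior_cases[OF mh E(1) T(1)] False interior_subset[of "\<Union>\<E>"] by (cases "T \<in> \<E>") auto
    then have "egrad T (w k) = 0"
      using w0[OF k] by (intro egrad_eqI_interior[OF mh _ T(1), where c=0])
        (auto simp: w nodal_interp(1)[OF mh])
    then show ?thesis using False by simp
  qed
  have B0: "0 \<le> \<kappa>^4 * ?B"
    unfolding B using \<kappa> S0 by (intro mult_nonneg_nonneg add_nonneg_nonneg) auto
  have "(\<Sum>k=1..N. grad_sq \<T>h (w k) x) \<le> (\<Sum>k=1..N. if interior T \<subseteq> D' k then \<kappa>^4 * ?B else 0)"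
    unfolding gs[of "w _"] by (intro sum_mono one)
  also have "\<dots> = real (card {k \<in> {1..N}. interior T \<subseteq> D' k}) * (\<kappa>^4 * ?B)"
    by (subst sum.inter_filter[symmetric]) auto
  also have "\<dots> \<le> real Nc * (\<kappa>^4 * ?B)"
    using card_subdomains_le_colors[OF col mesh_element(4)[OF mh T(1)]] B0
    by (intro mult_right_mono) auto
  finally show ?thesis by (simp add: mult.assoc)
qed

lemma sum_boundary_layers_le:
  fixes \<Omega> :: "'a::euclidean_space set"
  assumes o: "open \<Omega>" and b: "bounded \<Omega>" and \<kappa>: "\<kappa> \<ge> 1" and \<delta>: "\<delta> > 0"
    and mh: "mesh_of \<Omega> \<T>h" and mH: "mesh_of \<Omega> \<T>H" and qH: "quasi_uniform \<kappa> H \<T>H"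
    and e: "e \<in> fe_space \<T>h \<Omega>" and L: "diameter \<Omega> < R"
  shows "(\<Sum>K\<in>\<T>H. (\<integral>\<^sup>+x. indicator (boundary_layer (\<kappa> * \<delta>) K) x * ennreal ((e x)\<^sup>2) \<partial>lborel))
    \<le> ennreal (2 ^ DIM('a) * (4 * \<kappa>\<^sup>2 * \<delta> / H) * (4 * R\<^sup>2 + (\<kappa> * H)\<^sup>2) * energy \<T>h e)"
proof -
  have H: "H > 0" using qH by (simp add: quasi_uniform_def)
  \<comment> \<open>Twice the ratio of the layer width \<open>\<kappa> \<delta>\<close> and the inradius \<open>H / \<kappa>\<close>; the factor 2 makes the
    inequality required of \<open>s\<close> strict.\<close>
  define s where "s = 2 * \<kappa>\<^sup>2 * \<delta> / H"
  define C where "C = 2 ^ DIM('a) * ennreal (2 * s)"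
  have s0: "s \<ge> 0" using H \<delta> by (simp add: s_def)
  define U where "U x = ennreal ((e x)\<^sup>2)" for x
  define Q where "Q x = ennreal (grad_sq \<T>h e x)" for x
  have [measurable]: "Q \<in> borel_measurable borel"
    unfolding Q_def using grad_sq_measurable[OF mh] by measurable
  have [measurable]: "e \<in> borel_measurable borel"
    using fe_space_continuous[OF e o] by (rule borel_measurable_continuous_onI)
  have [measurable]: "U \<in> borel_measurable borel"
    unfolding U_def by measurable
  have "(\<Sum>K\<in>\<T>H. (\<integral>\<^sup>+x. indicator (boundary_layer (\<kappa> * \<delta>) K) x * U x \<partial>lborel))
    \<le> (\<Sum>K\<in>\<T>H. C * (4 * (\<integral>\<^sup>+x. indicator K x * U x \<partial>lborel)
        + ennreal ((\<kappa> * H)\<^sup>2) * (\<integral>\<^sup>+x. indicator K x * Q x \<partial>lborel)))"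
  proof (rule sum_mono)
    fix K assume K: "K \<in> \<T>H"
    obtain c where c: "cball c (H / \<kappa>) \<subseteq> K" "diameter K \<le> \<kappa> * H"
      using qH K by (auto simp: quasi_uniform_def)
    have "\<kappa> * \<delta> < s * (H / \<kappa>)"
      using H \<kappa> \<delta> by (simp add: s_def power2_eq_square)
    then show "(\<integral>\<^sup>+x. indicator (boundary_layer (\<kappa> * \<delta>) K) x * U x \<partial>lborel)
      \<le> C * (4 * (\<integral>\<^sup>+x. indicator K x * U x \<partial>lborel)
        + ennreal ((\<kappa> * H)\<^sup>2) * (\<integral>\<^sup>+x. indicator K x * Q x \<partial>lborel))"
      unfolding U_def Q_def C_def using H \<kappa> s0 c
      by (intro boundary_layer_estimate[OF mh o e mesh_element(1,2)[OF mH K] c(1)]) auto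
  qed
  also have "\<dots> = C * (4 * (\<Sum>K\<in>\<T>H. (\<integral>\<^sup>+x. indicator K x * U x \<partial>lborel))
      + ennreal ((\<kappa> * H)\<^sup>2) * (\<Sum>K\<in>\<T>H. (\<integral>\<^sup>+x. indicator K x * Q x \<partial>lborel)))"
    by (simp add: sum_distrib_left sum.distrib distrib_left)
  also have "\<dots> \<le> C * (4 * (\<integral>\<^sup>+x. U x \<partial>lborel) + ennreal ((\<kappa> * H)\<^sup>2) * (\<integral>\<^sup>+x. Q x \<partial>lborel))"
    by (intro mult_left_mono add_mono sum_nn_integral_elements_le[OF mH]) auto
  also have "\<dots> \<le> C * (4 * (ennreal (R\<^sup>2) * (\<integral>\<^sup>+x. Q x \<partial>lborel))
      + ennreal ((\<kappa> * H)\<^sup>2) * (\<integral>\<^sup>+x. Q x \<partial>lborel))"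
    using friedrichs_inequality[OF mh o b e L]
    by (intro mult_left_mono add_mono) (auto simp: U_def Q_def)
  also have "(\<integral>\<^sup>+x. Q x \<partial>lborel) = ennreal (energy \<T>h e)"
    unfolding Q_def by (rule nn_integral_grad_sq[OF mh])
  also have "C * (4 * (ennreal (R\<^sup>2) * ennreal (energy \<T>h e)) + ennreal ((\<kappa> * H)\<^sup>2) * ennreal (energy \<T>h e))
    = ennreal (2 ^ DIM('a) * (2 * s) * (4 * R\<^sup>2 + (\<kappa> * H)\<^sup>2) * energy \<T>h e)"
  proof -
    have "4 * (ennreal (R\<^sup>2) * ennreal (energy \<T>h e)) + ennreal ((\<kappa> * H)\<^sup>2) * ennreal (energy \<T>h e)
        = ennreal ((4 * R\<^sup>2 + (\<kappa> * H)\<^sup>2) * energy \<T>h e)"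
      by (simp add: ennreal_mult'' ennreal_plus[symmetric] energy_nonneg distrib_right mult.assoc
          ennreal_mult flip: ennreal_numeral)
    moreover have "C = ennreal (2 ^ DIM('a) * (2 * s))"
      using s0 by (simp add: C_def ennreal_mult ennreal_power[symmetric])
    ultimately show ?thesis
      using s0 energy_nonneg[of \<T>h e] by (simp add: ennreal_mult[symmetric] mult.assoc)
  qed
  finally show ?thesis by (simp add: U_def s_def mult_ac)
qed

text \<open>Integration of \<open>sum_grad_sq_le\<close> gives the bound \<open>|e|\<^sup>2 + \<delta>\<^sup>-\<^sup>2 (\<delta>/H) (L\<^sup>2 + H\<^sup>2) |e|\<^sup>2\<close> up to constants, with
\<open>L\<close> the diameter of \<open>\<Omega>\<close>. From \<open>\<delta> \<le> L\<close> and \<open>H \<le> \<kappa> L\<close> every term is at most a multiple of \<open>L\<^sup>2/(H\<delta>)\<close>.\<close>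

lemma sum_energy_le:
  fixes \<Omega> :: "'a::euclidean_space set"
  assumes reg: "interior (closure \<Omega>) = \<Omega>" and o: "open \<Omega>" and b: "bounded \<Omega>" and ne: "\<Omega> \<noteq> {}"
    and \<kappa>: "\<kappa> \<ge> 1"
    and mh: "mesh_of \<Omega> \<T>h" and qh: "quasi_uniform \<kappa> h \<T>h"
    and mH: "mesh_of \<Omega> \<T>H" and qH: "quasi_uniform \<kappa> H \<T>H" and ref: "mesh_refinement \<T>h \<T>H"
    and nd: "nonoverlapping_decomposition \<Omega> \<T>H M N D"
    and en: "enlarged_by_layers \<Omega> \<T>h \<kappa> N D \<delta> D'"
    and col: "colorable_with Nc N D'"
    and pu: "pl_partition_of_unity \<Omega> \<T>h \<kappa> N \<delta> D' \<theta>"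
    and e: "e \<in> fe_space \<T>h \<Omega>"
    and w: "\<And>k. w k = nodal_interp \<T>h \<Omega> (\<lambda>y. \<theta> k y * e y)"
    and w0: "\<And>k y. k \<in> {1..N} \<Longrightarrow> y \<notin> D' k \<Longrightarrow> w k y = 0"
  shows "(\<Sum>k=1..N. energy \<T>h (w k)) \<le> real Nc * (diameter \<Omega>)\<^sup>2
      * (8 * \<kappa>^5 + 2 ^ DIM('a) * 8 * \<kappa>^8 * (16 + \<kappa>^4)) * (1 / (H * \<delta>)) * energy \<T>h e"
proof -
  define L where "L = diameter \<Omega>"
  define E where "E = energy \<T>h e"
  have H: "H > 0" using qH by (simp add: quasi_uniform_def)
  have \<delta>: "\<delta> > 0" "\<delta> \<le> L" using en by (auto simp: enlarged_by_layers_def L_def)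
  have L: "L > 0" using \<delta> by simp
  have E0: "E \<ge> 0" by (simp add: E_def energy_nonneg)
  have HL: "H \<le> \<kappa> * L"
  proof -
    have "\<T>H \<noteq> {}" using mesh_Union[OF mH] ne closure_subset[of \<Omega>] by auto
    then obtain K where K: "K \<in> \<T>H" by blast
    obtain c where c: "cball c (H / \<kappa>) \<subseteq> K" using qH K by (auto simp: quasi_uniform_def)
    then have "cball c (H / \<kappa>) \<subseteq> closure \<Omega>" using mesh_element(5)[OF mH K] by blast
    then have "diameter (cball c (H / \<kappa>)) \<le> diameter (closure \<Omega>)"
      using b by (intro diameter_subset) auto
    then have "2 * (H / \<kappa>) \<le> L"
      using H \<kappa> diameter_closure[OF b] by (simp add: L_def not_less[symmetric] split: if_splits)
    moreover have "H / \<kappa> \<ge> 0" using H \<kappa> by simp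
    ultimately have "H / \<kappa> \<le> L" by linarith
    then show ?thesis using \<kappa> by (simp add: pos_divide_le_eq mult.commute)
  qed
  define a where "a = real Nc * \<kappa>^4 * 8"
  define b' where "b' = real Nc * \<kappa>^4 * (2 * (\<kappa> / \<delta>)\<^sup>2)"
  have ab0: "a \<ge> 0" "b' \<ge> 0" using \<kappa> by (auto simp: a_def b'_def)
  \<comment> \<open>The bound for the layers with \<open>R = 2 * L\<close>, since \<open>R\<close> has to exceed the diameter strictly.\<close>
  define G where "G = 2 ^ DIM('a) * (4 * \<kappa>\<^sup>2 * \<delta> / H) * (4 * (2 * L)\<^sup>2 + (\<kappa> * H)\<^sup>2) * E"
  have G0: "G \<ge> 0" unfolding G_def using H \<delta> E0 by (intro mult_nonneg_nonneg) auto
  have [measurable]: "boundary_layer (\<kappa> * \<delta>) K \<in> sets borel" if "K \<in> \<T>H" for K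
    using boundary_layer_closed[OF mesh_element(3)[OF mH that]] by simp
  have [measurable]: "grad_sq \<T>h u \<in> borel_measurable borel" for u
    by (rule grad_sq_measurable[OF mh])
  have [measurable]: "e \<in> borel_measurable borel"
    using fe_space_continuous[OF e o] by (rule borel_measurable_continuous_onI)
  have "ennreal (\<Sum>k=1..N. energy \<T>h (w k)) = (\<Sum>k=1..N. ennreal (energy \<T>h (w k)))"
    by (simp add: sum_ennreal energy_nonneg)
  also have "\<dots> = (\<Sum>k=1..N. (\<integral>\<^sup>+x. ennreal (grad_sq \<T>h (w k) x) \<partial>lborel))"
    by (simp add: nn_integral_grad_sq[OF mh])
  also have "\<dots> = (\<integral>\<^sup>+x. (\<Sum>k=1..N. ennreal (grad_sq \<T>h (w k) x)) \<partial>lborel)"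
    by (rule nn_integral_sum[symmetric]) measurable
  also have "\<dots> \<le> (\<integral>\<^sup>+x. ennreal a * ennreal (grad_sq \<T>h e x) + ennreal b' *
      (\<Sum>K\<in>\<T>H. indicator (boundary_layer (\<kappa> * \<delta>) K) x * ennreal ((e x)\<^sup>2)) \<partial>lborel)"
  proof (rule nn_integral_mono_AE)
    have "AE x in lborel. \<forall>T\<in>\<T>h. x \<in> T \<longrightarrow> x \<in> interior T"
      using AE_mesh_interior[OF mh] by (simp add: AE_completion_iff)
    then show "AE x in lborel. (\<Sum>k=1..N. ennreal (grad_sq \<T>h (w k) x))
      \<le> ennreal a * ennreal (grad_sq \<T>h e x) + ennreal b' *
      (\<Sum>K\<in>\<T>H. indicator (boundary_layer (\<kappa> * \<delta>) K) x * ennreal ((e x)\<^sup>2))"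
    proof (rule AE_mp, intro AE_I2 impI)
      fix x assume x: "\<forall>T\<in>\<T>h. x \<in> T \<longrightarrow> x \<in> interior T"
      let ?S = "\<Sum>K\<in>\<T>H. indicator (boundary_layer (\<kappa> * \<delta>) K) x * (e x)\<^sup>2"
      have S0: "0 \<le> ?S" by (intro sum_nonneg) auto
      have "(\<Sum>k=1..N. ennreal (grad_sq \<T>h (w k) x)) = ennreal (\<Sum>k=1..N. grad_sq \<T>h (w k) x)"
        by (simp add: sum_ennreal grad_sq_nonneg)
      also have "\<dots> \<le> ennreal (a * grad_sq \<T>h e x + b' * ?S)"
      proof (rule ennreal_leI)
        have "(\<Sum>k=1..N. grad_sq \<T>h (w k) x) \<le> real Nc * \<kappa>^4 * (8 * grad_sq \<T>h e x + 2 * (\<kappa> / \<delta>)\<^sup>2 * ?S)"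
          by (rule sum_grad_sq_le[OF reg \<kappa> mh qh mH ref nd en col pu e w w0 x])
        also have "\<dots> = a * grad_sq \<T>h e x + b' * ?S"
          by (simp only: a_def b'_def distrib_left mult.assoc)
        finally show "(\<Sum>k=1..N. grad_sq \<T>h (w k) x) \<le> a * grad_sq \<T>h e x + b' * ?S" .
      qed
      also have "\<dots> = ennreal a * ennreal (grad_sq \<T>h e x) + ennreal b' * ennreal ?S"
        using ab0 S0 by (simp add: ennreal_plus ennreal_mult grad_sq_nonneg)
      also have "ennreal ?S = (\<Sum>K\<in>\<T>H. ennreal (indicator (boundary_layer (\<kappa> * \<delta>) K) x * (e x)\<^sup>2))"
        by (rule sum_ennreal[symmetric]) auto
      also have "\<dots> = (\<Sum>K\<in>\<T>H. indicator (boundary_layer (\<kappa> * \<delta>) K) x * ennreal ((e x)\<^sup>2))"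
        by (rule sum.cong) (auto simp: indicator_def)
      finally show "(\<Sum>k=1..N. ennreal (grad_sq \<T>h (w k) x)) \<le> ennreal a * ennreal (grad_sq \<T>h e x) + ennreal b' *
        (\<Sum>K\<in>\<T>H. indicator (boundary_layer (\<kappa> * \<delta>) K) x * ennreal ((e x)\<^sup>2))" .
    qed
  qed
  also have "\<dots> = ennreal a * (\<integral>\<^sup>+x. ennreal (grad_sq \<T>h e x) \<partial>lborel) + ennreal b' *
      (\<integral>\<^sup>+x. (\<Sum>K\<in>\<T>H. indicator (boundary_layer (\<kappa> * \<delta>) K) x * ennreal ((e x)\<^sup>2)) \<partial>lborel)"
    by (subst nn_integral_add) (measurable, simp add: nn_integral_cmult)
  also have "(\<integral>\<^sup>+x. (\<Sum>K\<in>\<T>H. indicator (boundary_layer (\<kappa> * \<delta>) K) x * ennreal ((e x)\<^sup>2)) \<partial>lborel)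
      = (\<Sum>K\<in>\<T>H. (\<integral>\<^sup>+x. indicator (boundary_layer (\<kappa> * \<delta>) K) x * ennreal ((e x)\<^sup>2) \<partial>lborel))"
    by (rule nn_integral_sum) measurable
  also have "ennreal a * (\<integral>\<^sup>+x. ennreal (grad_sq \<T>h e x) \<partial>lborel) + ennreal b' * \<dots>
      \<le> ennreal a * ennreal E + ennreal b' * ennreal G"
    using sum_boundary_layers_le[OF o b \<kappa> \<delta>(1) mh mH qH e, of "2 * L"] L
    by (intro add_mono mult_left_mono) (auto simp: nn_integral_grad_sq[OF mh] E_def G_def L_def)
  also have "\<dots> = ennreal (a * E + b' * G)"
    using ab0 E0 G0 by (simp add: ennreal_mult)
  finally have "(\<Sum>k=1..N. energy \<T>h (w k)) \<le> a * E + b' * G"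
    using ab0 E0 G0 by (subst (asm) ennreal_le_iff) auto
  also have "\<dots> = real Nc * (8 * \<kappa>^4 * (H * \<delta>) + 2 ^ DIM('a) * 8 * \<kappa>^8 * (16 * L\<^sup>2 + (\<kappa> * H)\<^sup>2)) * (1 / (H * \<delta>)) * E"
  proof -
    define X where "X = 1 / (H * \<delta>)"
    have X1: "H * \<delta> * X = 1" using H \<delta> by (simp add: X_def)
    have X2: "2 * (\<kappa> / \<delta>)\<^sup>2 * (4 * \<kappa>\<^sup>2 * \<delta> / H) = 8 * (\<kappa>\<^sup>2 * \<kappa>\<^sup>2) * X"
      using H \<delta> by (simp add: X_def power2_eq_square mult_ac)
    have k: "\<kappa>^4 * (\<kappa>\<^sup>2 * \<kappa>\<^sup>2) = \<kappa>^8" by (simp flip: power_add)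
    have "b' * G = real Nc * \<kappa>^4 * 2 ^ DIM('a) * (2 * (\<kappa> / \<delta>)\<^sup>2 * (4 * \<kappa>\<^sup>2 * \<delta> / H))
        * (4 * (2 * L)\<^sup>2 + (\<kappa> * H)\<^sup>2) * E"
      by (simp only: b'_def G_def mult_ac)
    also have "\<dots> = real Nc * (2 ^ DIM('a) * 8 * (\<kappa>^4 * (\<kappa>\<^sup>2 * \<kappa>\<^sup>2)) * (4 * (2 * L)\<^sup>2 + (\<kappa> * H)\<^sup>2)) * X * E"
      unfolding X2 by (simp only: mult_ac)
    also have "4 * (2 * L)\<^sup>2 = 16 * L\<^sup>2" by (simp add: power_mult_distrib)
    finally have "b' * G = real Nc * (2 ^ DIM('a) * 8 * \<kappa>^8 * (16 * L\<^sup>2 + (\<kappa> * H)\<^sup>2)) * X * E"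
      by (simp only: k)
    moreover have "a * E = real Nc * (8 * \<kappa>^4 * (H * \<delta>)) * X * E"
    proof -
      have "real Nc * (8 * \<kappa>^4 * (H * \<delta>)) * X * E = real Nc * \<kappa>^4 * 8 * (H * \<delta> * X) * E"
        by (simp only: mult_ac)
      then show ?thesis by (simp only: X1 a_def mult_1_right)
    qed
    ultimately show ?thesis
      unfolding X_def[symmetric] by (simp only: distrib_left distrib_right)
  qed
  also have "\<dots> \<le> real Nc * (8 * \<kappa>^4 * (\<kappa> * L * L) + 2 ^ DIM('a) * 8 * \<kappa>^8 * (16 * L\<^sup>2 + (\<kappa> * (\<kappa> * L))\<^sup>2)) * (1 / (H * \<delta>)) * E"
  proof -
    have "H * \<delta> \<le> \<kappa> * L * L" using HL \<delta> H \<kappa> L by (intro mult_mono) auto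
    moreover have "(\<kappa> * H)\<^sup>2 \<le> (\<kappa> * (\<kappa> * L))\<^sup>2" using HL H \<kappa> by (intro power_mono mult_left_mono) auto
    ultimately show ?thesis
      using H \<delta> \<kappa> E0 by (intro mult_right_mono mult_left_mono add_mono) auto
  qed
  also have "\<dots> = real Nc * L\<^sup>2 * (8 * \<kappa>^5 + 2 ^ DIM('a) * 8 * \<kappa>^8 * (16 + \<kappa>^4)) * (1 / (H * \<delta>)) * E"
  proof -
    have "\<kappa>^4 * (\<kappa> * L * L) = L\<^sup>2 * \<kappa>^5" "16 * L\<^sup>2 + (\<kappa> * (\<kappa> * L))\<^sup>2 = L\<^sup>2 * (16 + \<kappa>^4)"
      by (simp_all add: power2_eq_square eval_nat_numeral algebra_simps)
    then show ?thesis by (simp only: mult.assoc) (simp only: distrib_left distrib_right mult_ac)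
  qed
  finally show ?thesis by (simp add: L_def E_def)
qed

section \<open>The stable decomposition\<close>

lemma interpolated_product_fe_space:
  fixes \<Omega> :: "'a::euclidean_space set"
  assumes mh: "mesh_of \<Omega> \<T>h" and reg: "interior (closure \<Omega>) = \<Omega>"
    and D: "union_of_elements \<T>h D" and e: "e \<in> fe_space \<T>h \<Omega>"
    and th: "\<And>x. x \<in> \<Omega> - D \<Longrightarrow> \<theta> x = 0"
  shows "nodal_interp \<T>h \<Omega> (\<lambda>y. \<theta> y * e y) \<in> fe_space \<T>h D"
proof -
  let ?w = "nodal_interp \<T>h \<Omega> (\<lambda>y. \<theta> y * e y)"
  obtain \<E> where E: "\<E> \<subseteq> \<T>h" "D = interior (\<Union>\<E>)"
    using D unfolding union_of_elements_def by blast
  have pw: "pw_linear \<T>h \<Omega> ?w" by (rule nodal_interp(1)[OF mh])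
  have w0: "?w x = 0" if x: "x \<notin> D" for x
  proof (cases "x \<in> closure \<Omega>")
    case True
    show ?thesis
    proof (rule pw_linear_zero_off_union[OF mh E(1) pw _ True])
      show "x \<notin> interior (\<Union>\<E>)" using x E by simp
      fix y assume y: "y \<in> mesh_vertices \<T>h" "y \<notin> interior (\<Union>\<E>)"
      have "\<theta> y * e y = 0"
        using th[of y] e y E by (cases "y \<in> \<Omega>") (auto simp: fe_space_def)
      then show "?w y = 0" using nodal_interp(2)[OF mh y(1)] by simp
    qed
  qed (rule nodal_interp(3)[OF mh])
  have "D \<subseteq> closure \<Omega>"
    using E mesh_Union[OF mh] interior_subset[of "\<Union>\<E>"] by blast
  then have sub: "closure D \<subseteq> closure \<Omega>" by (simp add: closure_minimal)
  have "pw_linear \<T>h D ?w"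
    using pw sub unfolding pw_linear_def by (meson continuous_on_subset subset_trans)
  then show ?thesis using w0 by (simp add: fe_space_def)
qed

lemma sum_interpolated_products:
  fixes \<Omega> :: "'a::euclidean_space set"
  assumes mh: "mesh_of \<Omega> \<T>h" and e: "e \<in> fe_space \<T>h \<Omega>"
    and th: "\<And>x. x \<in> closure \<Omega> \<Longrightarrow> (\<Sum>k\<in>I. \<theta> k x) = 1"
  shows "(\<Sum>k\<in>I. nodal_interp \<T>h \<Omega> (\<lambda>y. \<theta> k y * e y) x) = e x"
proof (cases "x \<in> closure \<Omega>")
  case True
  show ?thesis
  proof (rule pw_linear_unique[OF mh _ _ _ True])
    show "pw_linear \<T>h \<Omega> (\<lambda>x. \<Sum>k\<in>I. nodal_interp \<T>h \<Omega> (\<lambda>y. \<theta> k y * e y) x)"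
      by (rule pw_linear_sum[OF nodal_interp(1)[OF mh]])
    show "pw_linear \<T>h \<Omega> e" using e by (simp add: fe_space_def)
    fix y assume y: "y \<in> mesh_vertices \<T>h"
    then have "y \<in> closure \<Omega>" using mesh_vertices_subset[OF mh] by blast
    then show "(\<Sum>k\<in>I. nodal_interp \<T>h \<Omega> (\<lambda>y. \<theta> k y * e y) y) = e y"
      by (simp add: nodal_interp(2)[OF mh y] th flip: sum_distrib_right)
  qed
next
  case False
  then have "e x = 0" using e closure_subset[of \<Omega>] by (auto simp: fe_space_def)
  then show ?thesis using False by (simp add: nodal_interp(3)[OF mh])
qed

lemma fe_space_diff:
  assumes "u \<in> fe_space \<T> D" "v \<in> fe_space \<T> D"
  shows "(\<lambda>x. u x - v x) \<in> fe_space \<T> D"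
  using assms pw_linear_lincomb[of \<T> D u v 1 "-1"] by (simp add: fe_space_def)

theorem theorem4p1:
  fixes \<Omega> :: "'a::euclidean_space set" and \<kappa> :: real and M :: nat
  assumes "DIM('a) = 2 \<or> DIM('a) = 3"
    and "polyhedral_domain \<Omega>"
    and "\<kappa> \<ge> 1"
  shows "\<exists>c1>0. \<exists>c2>0.
    \<forall>(\<T>h :: 'a set set) (h :: real) (\<T>H :: 'a set set) (H :: real) (N :: nat)
      (D :: nat \<Rightarrow> 'a set) (\<delta> :: real) (D' :: nat \<Rightarrow> 'a set) (\<theta> :: nat \<Rightarrow> 'a \<Rightarrow> real)
      (\<phi> :: 'a \<Rightarrow> real \<Rightarrow> real).
      mesh_of \<Omega> \<T>h \<and> quasi_uniform \<kappa> h \<T>h \<and>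
      mesh_of \<Omega> \<T>H \<and> quasi_uniform \<kappa> H \<T>H \<and>
      mesh_refinement \<T>h \<T>H \<and>
      nonoverlapping_decomposition \<Omega> \<T>H M N D \<and>
      enlarged_by_layers \<Omega> \<T>h \<kappa> N D \<delta> D' \<and>
      colorable_with (if DIM('a) = 2 then 4 else 8) N D' \<and>
      pl_partition_of_unity \<Omega> \<T>h \<kappa> N \<delta> D' \<theta> \<and>
      admissible_nonlinearity \<Omega> \<phi>
      \<longrightarrow>
      (\<exists>C0>0.
         c1 * (1 / (H * \<delta>)) \<le> C0\<^sup>2 \<and> C0\<^sup>2 \<le> c2 * (1 / (H * \<delta>)) \<and>
         (\<forall>u\<in>fe_space \<T>h \<Omega>. \<forall>v\<in>fe_space \<T>h \<Omega>.
            \<exists>w :: nat \<Rightarrow> 'a \<Rightarrow> real.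
              (\<forall>k\<in>{1..N}. w k \<in> fe_space \<T>h (D' k)) \<and>
              (\<lambda>x. u x - v x) = (\<lambda>x. \<Sum>k=1..N. extend_zero (D' k) (w k) x) \<and>
              (\<Sum>k=1..N. bregman (F_h \<Omega>) (\<lambda>x. v x + extend_zero (D' k) (w k) x) v)
                \<le> C0\<^sup>2 / 2 * (H1_seminorm \<Omega> (\<lambda>x. u x - v x))\<^sup>2 \<and>
              (\<Sum>k=1..N. G_h \<T>h \<Omega> \<phi> (\<lambda>x. v x + extend_zero (D' k) (w k) x))
                \<le> G_h \<T>h \<Omega> \<phi> u + (real N - 1) * G_h \<T>h \<Omega> \<phi> v))"
proof -
  note reg = polyhedral_domain_regular[OF assms(2)]
  have \<kappa>: "\<kappa> \<ge> 1" by fact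
  define Nc :: nat where "Nc = (if DIM('a) = 2 then 4 else 8)"
  define c where "c = real Nc * (diameter \<Omega>)\<^sup>2 * (8 * \<kappa>^5 + 2 ^ DIM('a) * 8 * \<kappa>^8 * (16 + \<kappa>^4))"
  have c0: "c > 0"
  proof -
    obtain x where "x \<in> \<Omega>" using reg(4) by auto
    then obtain r where r: "r > 0" "cball x r \<subseteq> \<Omega>"
      using reg(2) open_contains_cball by blast
    then have "diameter (cball x r) \<le> diameter \<Omega>"
      using reg(3) by (intro diameter_subset) auto
    then have "diameter \<Omega> > 0" using r by simp
    then show ?thesis
      unfolding c_def using \<kappa> by (intro mult_pos_pos add_pos_pos) (auto simp: Nc_def)
  qed
  show ?thesis
  proof (rule exI[of _ c], rule conjI[OF c0], rule exI[of _ c], rule conjI[OF c0], intro allI impI)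
    fix \<T>h \<T>H :: "'a set set" and h H \<delta> :: real and N :: nat and D D' :: "nat \<Rightarrow> 'a set"
      and \<theta> :: "nat \<Rightarrow> 'a \<Rightarrow> real" and \<phi> :: "'a \<Rightarrow> real \<Rightarrow> real"
    assume A: "mesh_of \<Omega> \<T>h \<and> quasi_uniform \<kappa> h \<T>h \<and>
      mesh_of \<Omega> \<T>H \<and> quasi_uniform \<kappa> H \<T>H \<and>
      mesh_refinement \<T>h \<T>H \<and>
      nonoverlapping_decomposition \<Omega> \<T>H M N D \<and>
      enlarged_by_layers \<Omega> \<T>h \<kappa> N D \<delta> D' \<and>
      colorable_with (if DIM('a) = 2 then 4 else 8) N D' \<and>
      pl_partition_of_unity \<Omega> \<T>h \<kappa> N \<delta> D' \<theta> \<and>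
      admissible_nonlinearity \<Omega> \<phi>"
    then have mh: "mesh_of \<Omega> \<T>h" and qh: "quasi_uniform \<kappa> h \<T>h"
      and mH: "mesh_of \<Omega> \<T>H" and qH: "quasi_uniform \<kappa> H \<T>H" and ref: "mesh_refinement \<T>h \<T>H"
      and nd: "nonoverlapping_decomposition \<Omega> \<T>H M N D"
      and en: "enlarged_by_layers \<Omega> \<T>h \<kappa> N D \<delta> D'"
      and col: "colorable_with Nc N D'"
      and pu: "pl_partition_of_unity \<Omega> \<T>h \<kappa> N \<delta> D' \<theta>"
      and ad: "admissible_nonlinearity \<Omega> \<phi>"
      unfolding Nc_def by blast+
    have pos: "H > 0" "\<delta> > 0"
      using qH en by (auto simp: quasi_uniform_def enlarged_by_layers_def)
    define C0 where "C0 = sqrt (c * (1 / (H * \<delta>)))"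
    have C0: "C0 > 0" "C0\<^sup>2 = c * (1 / (H * \<delta>))"
      using pos c0 by (auto simp: C0_def)
    have th0: "\<theta> k x = 0" if "k \<in> {1..N}" "x \<in> \<Omega> - D' k" for k x
      using pu that unfolding pl_partition_of_unity_def by blast
    have th01: "0 \<le> \<theta> k x" "\<theta> k x \<le> 1" if "k \<in> {1..N}" "x \<in> closure \<Omega>" for k x
      using pu that unfolding pl_partition_of_unity_def by blast+
    have th1: "(\<Sum>k=1..N. \<theta> k x) = 1" if "x \<in> closure \<Omega>" for x
      using pu that unfolding pl_partition_of_unity_def by blast
    have Dk: "union_of_elements \<T>h (D' k)" if "k \<in> {1..N}" for k
      using en that unfolding enlarged_by_layers_def by blast
    have main: "\<exists>w :: nat \<Rightarrow> 'a \<Rightarrow> real.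
              (\<forall>k\<in>{1..N}. w k \<in> fe_space \<T>h (D' k)) \<and>
              (\<lambda>x. u x - v x) = (\<lambda>x. \<Sum>k=1..N. extend_zero (D' k) (w k) x) \<and>
              (\<Sum>k=1..N. bregman (F_h \<Omega>) (\<lambda>x. v x + extend_zero (D' k) (w k) x) v)
                \<le> C0\<^sup>2 / 2 * (H1_seminorm \<Omega> (\<lambda>x. u x - v x))\<^sup>2 \<and>
              (\<Sum>k=1..N. G_h \<T>h \<Omega> \<phi> (\<lambda>x. v x + extend_zero (D' k) (w k) x))
                \<le> G_h \<T>h \<Omega> \<phi> u + (real N - 1) * G_h \<T>h \<Omega> \<phi> v"
      if u: "u \<in> fe_space \<T>h \<Omega>" and v: "v \<in> fe_space \<T>h \<Omega>" for u v
    proof -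
      define e where "e x = u x - v x" for x
      have e: "e \<in> fe_space \<T>h \<Omega>"
        unfolding e_def[abs_def] by (rule fe_space_diff[OF u v])
      have pv: "pw_linear \<T>h \<Omega> v" and pe: "pw_linear \<T>h \<Omega> e"
        using v e by (auto simp: fe_space_def)
      define w where "w k = nodal_interp \<T>h \<Omega> (\<lambda>y. \<theta> k y * e y)" for k
      have wfe: "w k \<in> fe_space \<T>h (D' k)" if "k \<in> {1..N}" for k
        unfolding w_def using th0[OF that]
        by (intro interpolated_product_fe_space[OF mh reg(1) Dk[OF that] e]) auto
      have w0: "w k y = 0" if "k \<in> {1..N}" "y \<notin> D' k" for k y
        using wfe[OF that(1)] that(2) by (simp add: fe_space_def)
      have ez: "extend_zero (D' k) (w k) = w k" if "k \<in> {1..N}" for k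
        using w0[OF that] by (auto simp: extend_zero_def)
      have pww: "pw_linear \<T>h \<Omega> (w k)" for k
        unfolding w_def by (rule nodal_interp(1)[OF mh])
      have sum: "(\<lambda>x. u x - v x) = (\<lambda>x. \<Sum>k=1..N. extend_zero (D' k) (w k) x)"
      proof
        fix x
        have "(\<Sum>k=1..N. extend_zero (D' k) (w k) x) = (\<Sum>k=1..N. w k x)"
          by (rule sum.cong) (simp_all add: ez)
        also have "\<dots> = e x"
          unfolding w_def by (rule sum_interpolated_products[OF mh e th1])
        finally show "u x - v x = (\<Sum>k=1..N. extend_zero (D' k) (w k) x)" by (simp add: e_def)
      qed
      have "(\<Sum>k=1..N. bregman (F_h \<Omega>) (\<lambda>x. v x + extend_zero (D' k) (w k) x) v)
          = (\<Sum>k=1..N. energy \<T>h (w k)) / 2"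
        unfolding sum_divide_distrib
        by (rule sum.cong) (simp_all add: ez bregman_F_h[OF mh reg(1) pv pww])
      also have "\<dots> \<le> C0\<^sup>2 * energy \<T>h e / 2"
        using sum_energy_le[OF reg \<kappa> mh qh mH qH ref nd en col pu e w_def w0]
        by (simp add: C0 c_def)
      also have "energy \<T>h e = (H1_seminorm \<Omega> (\<lambda>x. u x - v x))\<^sup>2"
        using H1_seminorm_energy[OF mh reg(1) pe] by (simp add: e_def[abs_def])
      finally have breg: "(\<Sum>k=1..N. bregman (F_h \<Omega>) (\<lambda>x. v x + extend_zero (D' k) (w k) x) v)
          \<le> C0\<^sup>2 / 2 * (H1_seminorm \<Omega> (\<lambda>x. u x - v x))\<^sup>2" by simp
      have "(\<Sum>k=1..N. G_h \<T>h \<Omega> \<phi> (\<lambda>x. v x + w k x))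
          \<le> G_h \<T>h \<Omega> \<phi> u + (real N - 1) * G_h \<T>h \<Omega> \<phi> v"
      proof (rule G_h_sum_le[OF mh reg(3,2)])
        fix x assume x: "x \<in> mesh_vertices \<T>h"
        then have xc: "x \<in> closure \<Omega>" using mesh_vertices_subset[OF mh] by blast
        have wx: "w k x = \<theta> k x * e x" for k
          unfolding w_def by (rule nodal_interp(2)[OF mh x])
        show "(\<Sum>k=1..N. \<phi> x (v x + w k x)) \<le> \<phi> x (u x) + (real N - 1) * \<phi> x (v x)"
        proof (cases "x \<in> \<Omega>")
          case True
          have cv: "convex_on UNIV (\<phi> x)"
            using ad True by (simp add: admissible_nonlinearity_def)
          have "(\<Sum>k=1..N. \<phi> x (v x + w k x)) \<le> (\<Sum>k=1..N. \<phi> x (v x) + \<theta> k x * (\<phi> x (u x) - \<phi> x (v x)))"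
          proof (rule sum_mono)
            fix k assume k: "k \<in> {1..N}"
            have "\<phi> x ((1 - \<theta> k x) *\<^sub>R v x + \<theta> k x *\<^sub>R u x) \<le> (1 - \<theta> k x) * \<phi> x (v x) + \<theta> k x * \<phi> x (u x)"
              using th01[OF k xc] by (intro convex_onD[OF cv]) auto
            then show "\<phi> x (v x + w k x) \<le> \<phi> x (v x) + \<theta> k x * (\<phi> x (u x) - \<phi> x (v x))"
              by (simp add: wx e_def algebra_simps)
          qed
          also have "\<dots> = real N * \<phi> x (v x) + (\<Sum>k=1..N. \<theta> k x) * (\<phi> x (u x) - \<phi> x (v x))"
            by (simp add: sum.distrib sum_distrib_right)
          also have "\<dots> = \<phi> x (u x) + (real N - 1) * \<phi> x (v x)"
            unfolding th1[OF xc] by (simp add: algebra_simps)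
          finally show ?thesis .
        next
          case False
          then have "u x = 0" "v x = 0" "e x = 0" using u v e by (auto simp: fe_space_def)
          then show ?thesis by (simp add: wx algebra_simps)
        qed
      qed
      moreover have "(\<Sum>k=1..N. G_h \<T>h \<Omega> \<phi> (\<lambda>x. v x + extend_zero (D' k) (w k) x))
          = (\<Sum>k=1..N. G_h \<T>h \<Omega> \<phi> (\<lambda>x. v x + w k x))"
        by (rule sum.cong) (simp_all add: ez)
      ultimately show ?thesis
        using wfe sum breg by (intro exI[of _ w]) auto
    qed
    show "\<exists>C0>0. c * (1 / (H * \<delta>)) \<le> C0\<^sup>2 \<and> C0\<^sup>2 \<le> c * (1 / (H * \<delta>)) \<and>
         (\<forall>u\<in>fe_space \<T>h \<Omega>. \<forall>v\<in>fe_space \<T>h \<Omega>.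
            \<exists>w :: nat \<Rightarrow> 'a \<Rightarrow> real.
              (\<forall>k\<in>{1..N}. w k \<in> fe_space \<T>h (D' k)) \<and>
              (\<lambda>x. u x - v x) = (\<lambda>x. \<Sum>k=1..N. extend_zero (D' k) (w k) x) \<and>
              (\<Sum>k=1..N. bregman (F_h \<Omega>) (\<lambda>x. v x + extend_zero (D' k) (w k) x) v)
                \<le> C0\<^sup>2 / 2 * (H1_seminorm \<Omega> (\<lambda>x. u x - v x))\<^sup>2 \<and>
              (\<Sum>k=1..N. G_h \<T>h \<Omega> \<phi> (\<lambda>x. v x + extend_zero (D' k) (w k) x))
                \<le> G_h \<T>h \<Omega> \<phi> u + (real N - 1) * G_h \<T>h \<Omega> \<phi> v)"
      using C0 main by (intro exI[of _ C0] conjI ballI) auto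
  qed
qed

end
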